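(* Consider the $N$-player game with decentralized Markov policies described in the context, with $\lambda_{ij}+\lambda_{ji}>0$ for at least one pair $i<j$. Suppose that $C_i(\phi)\ge0$ and $\mathcal K_{ij}(\phi)\ge0$ for all $\phi\in\Pi$, all $i\in[N]$ and all $i<j$, and that $\operatorname{SC}^{\rm opt}>0$. Then for all $p\in(0,\infty)^N$ and all $\phi^p\in\arg\min_{\phi\in\Pi}\Phi^p(\phi)$, $$\operatorname{InEff}(\phi^p)\le\frac{\overline\gamma(p)}{\underline\gamma(p)},$$ where $$\underline\gamma(p):=\min\left\{\min_{i\in[N]}p_i,\ \min_{\substack{1\le i<j\le N\\ \lambda_{ij}+\lambda_{ji}>0}}\frac{p_i\lambda_{ij}+p_j\lambda_{ji}}{2(\lambda_{ij}+\lambda_{ji})}\right\},$$ $$\overline\gamma(p):=\max\left\{\max_{i\in[N]}p_i,\ \max_{\substack{1\le i<j\le N\\ \lambda_{ij}+\lambda_{ji}>0}}\frac{p_i\lambda_{ij}+p_j\lambda_{ji}}{2(\lambda_{ij}+\lambda_{ji})}\right\}.$$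
   Context: Setting. $T>0$ is a fixed horizon, $[N]=\{1,\dots,N\}$ is the set of players, and $d,k,m\in\mathbb{N}$. For each $i\in[N]$, $A_i\subset\mathbb{R}^k$ is a nonempty compact action set, and $\Pi_i\subset C([0,T]\times\mathbb{R}^d;A_i)$ is a nonempty set of admissible policies, each locally Lipschitz continuous in the spatial variable (uniformly in $t\in[0,T]$). Standing assumption: each $\Pi_i$ is compact in the compact-open topology (uniform convergence on compact subsets of $[0,T]\times\mathbb{R}^d$). Let $\Pi=\prod_{i\in[N]}\Pi_i$. Dynamics. $W$ is an $m$-dimensional Brownian motion on a complete probability space $(\Omega,\mathcal F,\mathbb P)$. For $\phi_i\in\Pi_i$, player $i$'s state $X_i^{\phi_i}$ solves $$dX_{i,t}=b_i(X_{i,t},\phi_i(t,X_{i,t}))\,dt+\sigma_i(X_{i,t},\phi_i(t,X_{i,t}))\,dW_t,\quad X_{i,0}=\xi_i,\quad t\in[0,T],$$ with $\xi_i\in\mathbb{R}^d$ given and $b_i:\mathbb{R}^d\times A_i\to\mathbb{R}^d$, $\sigma_i:\mathbb{R}^d\times A_i\to\mathbb{R}^{d\times m}$ Lipschitz continuous. Costs. For $\phi=(\phi_i)_{i\in[N]}\in\Pi$, player $i$'s cost is $$J_i(\phi)=\mathbb{E}\left[\int_0^T\Big(f_i\big(X^{\phi_i}_{i,t},\phi_i(t,X^{\phi_i}_{i,t})\big)+\sum_{j\ne i}\lambda_{ij}K(X^{\phi_i}_{i,t}-X^{\phi_j}_{j,t})\Big)dt+g_i(X^{\phi_i}_{i,T})\right],$$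 where $\lambda_{ij}\ge 0$ are constants, $f_i:\mathbb{R}^d\times A_i\to\mathbb{R}$ and $g_i:\mathbb{R}^d\to\mathbb{R}$ are continuous with at most quadratic growth, and $K:\mathbb{R}^d\to\mathbb{R}$ is bounded and continuous with $K(x)=K(-x)$ for all $x$ and $K\not\equiv0$. Cost components. $$C_i(\phi):=\mathbb{E}\left[\int_0^T f_i\big(X^{\phi_i}_{i,t},\phi_i(t,X^{\phi_i}_{i,t})\big)dt+g_i(X^{\phi_i}_{i,T})\right],\qquad \mathcal K_{ij}(\phi):=\mathbb{E}\left[\int_0^T K\big(X^{\phi_i}_{i,t}-X^{\phi_j}_{j,t}\big)dt\right].$$ Rescaled potential. For $p\in(0,\infty)^N$, $$\Phi^p(\phi):=\sum_{i=1}^N p_iC_i(\phi)+\frac12\sum_{1\le i<j\le N}(p_i\lambda_{ij}+p_j\lambda_{ji})\mathcal K_{ij}(\phi),\qquad \phi\in\Pi.$$ Social cost and inefficiency. $\operatorname{SC}(\phi):=\sum_{i=1}^N J_i(\phi)$, $\operatorname{SC}^{\rm opt}:=\inf_{\phi\in\Pi}\operatorname{SC}(\phi)$, and $\operatorname{InEff}(\phi):=\operatorname{SC}(\phi)/\operatorname{SC}^{\rm opt}$. *)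

theory Defs
  imports "HOL-Probability.Probability"
begin

section \<open>The compact-open topology\<close>

text \<open>Continuous maps are represented by functions that are \<^const>\<open>undefined\<close> outside the
  domain, so that equality of such functions is equality of maps.  Taking \<open>K = {}\<close>
  shows that the topological space consists of all continuous maps from \<open>S\<close> to \<open>Y\<close>.\<close>

definition compact_open_topology :: "'a topology \<Rightarrow> 'b topology \<Rightarrow> ('a \<Rightarrow> 'b) topology" where
  "compact_open_topology S Y = topology_generated_by
     {{h \<in> extensional (topspace S). continuous_map S Y h \<and> h ` K \<subseteq> U} | K U.
        compactin S K \<and> openin Y U}"


section \<open>Brownian motion and the Ito integral\<close>

locale brownian_motion = prob_space M for M :: "'w measure" +
  fixes W :: "real \<Rightarrow> 'w \<Rightarrow> real ^ 'm"
  assumes W_measurable: "\<And>t. 0 \<le> t \<Longrightarrow> W t \<in> borel_measurable M"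
    and W_zero: "AE w in M. W 0 w = 0"
    and W_continuous: "AE w in M. continuous_on {0..} (\<lambda>t. W t w)"
    and W_normal: "\<And>s t j. 0 \<le> s \<Longrightarrow> s < t \<Longrightarrow>
          distributed M lborel (\<lambda>w. (W t w - W s w) $ j) (normal_density 0 (sqrt (t - s)))"
    and W_indep_components: "\<And>s t. 0 \<le> s \<Longrightarrow> s < t \<Longrightarrow>
          indep_vars (\<lambda>_. borel) (\<lambda>j w. (W t w - W s w) $ j) UNIV"
    and W_indep_increments: "\<And>s t. 0 \<le> s \<Longrightarrow> s < t \<Longrightarrow>
          indep_set
            (sigma_sets (space M) {W u -` B \<inter> space M | u B. u \<in> {0..s} \<and> B \<in> sets borel})
            {(\<lambda>w. W t w - W s w) -` B \<inter> space M | B. B \<in> sets borel}"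
begin

text \<open>The filtration generated by \<open>W\<close>, augmented by the null sets of \<open>M\<close>.\<close>

definition brownian_filtration :: "real \<Rightarrow> 'w measure" where
  "brownian_filtration t = sigma (space M)
     ({W u -` B \<inter> space M | u B. u \<in> {0..t} \<and> B \<in> sets borel} \<union> null_sets M)"

definition progressive :: "real \<Rightarrow> (real \<Rightarrow> 'w \<Rightarrow> 'b::topological_space) \<Rightarrow> bool" where
  "progressive T H \<longleftrightarrow> (\<forall>t\<in>{0..T}.
     (\<lambda>(s, w). H s w) \<in> borel_measurable (restrict_space borel {0..t} \<Otimes>\<^sub>M brownian_filtration t))"

text \<open>Elementary integrands
  \<open>\<Sum>\<^sub>k \<xi>\<^sub>k 1\<^bsub>(\<tau>\<^sub>k, \<tau>\<^sub>k\<^sub>+\<^sub>1]\<^esub>\<close> with \<open>\<xi>\<^sub>k\<close> bounded and known at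
  time \<open>\<tau>\<^sub>k\<close>, and their integrals against \<open>W\<close>.\<close>

definition elementary :: "real \<Rightarrow> nat \<Rightarrow> (nat \<Rightarrow> real) \<Rightarrow> (nat \<Rightarrow> 'w \<Rightarrow> real ^ 'm ^ 'd) \<Rightarrow> bool" where
  "elementary T n \<tau> \<xi> \<longleftrightarrow>
     (\<forall>k\<le>n. \<tau> k \<in> {0..T}) \<and> (\<forall>k<n. \<tau> k < \<tau> (Suc k)) \<and>
     (\<forall>k<n. \<xi> k \<in> borel_measurable (brownian_filtration (\<tau> k))) \<and>
     (\<forall>k<n. \<exists>c. \<forall>w\<in>space M. norm (\<xi> k w) \<le> c)"

definition elementary_process ::
    "nat \<Rightarrow> (nat \<Rightarrow> real) \<Rightarrow> (nat \<Rightarrow> 'w \<Rightarrow> real ^ 'm ^ 'd) \<Rightarrow> real \<Rightarrow> 'w \<Rightarrow> real ^ 'm ^ 'd" where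
  "elementary_process n \<tau> \<xi> t w = (\<Sum>k<n. if \<tau> k < t \<and> t \<le> \<tau> (Suc k) then \<xi> k w else 0)"

definition elementary_integral ::
    "nat \<Rightarrow> (nat \<Rightarrow> real) \<Rightarrow> (nat \<Rightarrow> 'w \<Rightarrow> real ^ 'm ^ 'd) \<Rightarrow> real \<Rightarrow> 'w \<Rightarrow> real ^ 'd" where
  "elementary_integral n \<tau> \<xi> t w =
     (\<Sum>k<n. \<xi> k w *v (W (min t (\<tau> (Suc k))) w - W (min t (\<tau> k)) w))"

text \<open>\<open>I\<close> is a continuous version of \<open>t \<mapsto> \<integral>\<^sub>0\<^sup>t H\<^sub>s dW\<^sub>s\<close> on \<open>[0,T]\<close>: the integrand is
  progressively measurable and square integrable over \<open>[0,T] \<times> \<Omega>\<close>, and the integral is the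
  \<open>L\<^sup>2\<close> limit of the integrals of elementary processes that approximate \<open>H\<close> in \<open>L\<^sup>2\<close>.  The norm of
  the matrix type is the Frobenius norm.\<close>

definition ito_integral ::
    "real \<Rightarrow> (real \<Rightarrow> 'w \<Rightarrow> real ^ 'm ^ 'd) \<Rightarrow> (real \<Rightarrow> 'w \<Rightarrow> real ^ 'd) \<Rightarrow> bool" where
  "ito_integral T H I \<longleftrightarrow>
     progressive T H \<and>
     (\<integral>\<^sup>+ w. (\<integral>\<^sup>+ t\<in>{0..T}. ennreal ((norm (H t w))\<^sup>2) \<partial>lborel) \<partial>M) < \<infinity> \<and>
     progressive T I \<and> (AE w in M. continuous_on {0..T} (\<lambda>t. I t w)) \<and>
     (\<exists>n \<tau> \<xi>. (\<forall>l. elementary T (n l) (\<tau> l) (\<xi> l)) \<and>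
        ((\<lambda>l::nat. \<integral>\<^sup>+ w. (\<integral>\<^sup>+ t\<in>{0..T}.
            ennreal ((norm (elementary_process (n l) (\<tau> l) (\<xi> l) t w - H t w))\<^sup>2) \<partial>lborel) \<partial>M)
          \<longlonglongrightarrow> 0) \<and>
        (\<forall>t\<in>{0..T}. (\<lambda>l. \<integral>\<^sup>+ w.
            ennreal ((norm (elementary_integral (n l) (\<tau> l) (\<xi> l) t w - I t w))\<^sup>2) \<partial>M)
          \<longlonglongrightarrow> 0))"

text \<open>\<open>dX = \<beta>(t, X) dt + \<Sigma>(t, X) dW\<close> on \<open>[0,T]\<close> with \<open>X\<^sub>0 = x\<^sub>0\<close>, in the strong sense.\<close>

definition sde_solution ::
    "real \<Rightarrow> real ^ 'd \<Rightarrow> (real \<Rightarrow> real ^ 'd \<Rightarrow> real ^ 'd) \<Rightarrow> (real \<Rightarrow> real ^ 'd \<Rightarrow> real ^ 'm ^ 'd) \<Rightarrow>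
     (real \<Rightarrow> 'w \<Rightarrow> real ^ 'd) \<Rightarrow> bool" where
  "sde_solution T x0 \<beta> \<Sigma> X \<longleftrightarrow>
     progressive T X \<and> (AE w in M. continuous_on {0..T} (\<lambda>t. X t w)) \<and>
     (AE w in M. set_integrable lborel {0..T} (\<lambda>s. \<beta> s (X s w))) \<and>
     (\<exists>I. ito_integral T (\<lambda>s w. \<Sigma> s (X s w)) I \<and>
        (AE w in M. \<forall>t\<in>{0..T}.
           X t w = x0 + (LBINT s:{0..t}. \<beta> s (X s w)) + I t w))"

end


section \<open>The game\<close>

type_synonym ('d, 'k) policy = "real \<times> (real ^ 'd) \<Rightarrow> real ^ 'k"

text \<open>\<open>X i \<phi>\<close> is the state of player \<open>i\<close> under the policy \<open>\<phi> \<in> Pol i\<close>; it is given as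
  a parameter that is only required to solve the state equation.\<close>

locale decentralized_game = brownian_motion M W + complete_measure M
  for M :: "'w measure" and W :: "real \<Rightarrow> 'w \<Rightarrow> real ^ 'm" +
  fixes T :: real and N :: nat
    and A :: "nat \<Rightarrow> (real ^ 'k) set"
    and Pol :: "nat \<Rightarrow> ('d::finite, 'k::finite) policy set"
    and b :: "nat \<Rightarrow> (real ^ 'd) \<times> (real ^ 'k) \<Rightarrow> real ^ 'd"
    and \<sigma> :: "nat \<Rightarrow> (real ^ 'd) \<times> (real ^ 'k) \<Rightarrow> real ^ 'm ^ 'd"
    and \<xi> :: "nat \<Rightarrow> real ^ 'd"
    and f :: "nat \<Rightarrow> (real ^ 'd) \<times> (real ^ 'k) \<Rightarrow> real"
    and g :: "nat \<Rightarrow> real ^ 'd \<Rightarrow> real"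
    and lam :: "nat \<Rightarrow> nat \<Rightarrow> real"
    and K :: "real ^ 'd \<Rightarrow> real"
    and X :: "nat \<Rightarrow> ('d, 'k) policy \<Rightarrow> real \<Rightarrow> 'w \<Rightarrow> real ^ 'd"
  assumes T_pos: "0 < T"
    and N_pos: "1 \<le> N"
    and A: "\<And>i. i \<in> {1..N} \<Longrightarrow> A i \<noteq> {} \<and> compact (A i)"
    and Pol_nonempty: "\<And>i. i \<in> {1..N} \<Longrightarrow> Pol i \<noteq> {}"
    and Pol_continuous: "\<And>i \<phi>. i \<in> {1..N} \<Longrightarrow> \<phi> \<in> Pol i \<Longrightarrow>
          \<phi> \<in> extensional ({0..T} \<times> UNIV) \<and> continuous_on ({0..T} \<times> UNIV) \<phi> \<and>
          \<phi> ` ({0..T} \<times> UNIV) \<subseteq> A i"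
    and Pol_lipschitz: "\<And>i \<phi> R. i \<in> {1..N} \<Longrightarrow> \<phi> \<in> Pol i \<Longrightarrow>
          \<exists>L. \<forall>t\<in>{0..T}. L-lipschitz_on (cball 0 R) (\<lambda>x. \<phi> (t, x))"
    and Pol_compact: "\<And>i. i \<in> {1..N} \<Longrightarrow>
          compactin (compact_open_topology (top_of_set ({0..T} \<times> UNIV)) (top_of_set (A i))) (Pol i)"
    and b_lipschitz: "\<And>i. i \<in> {1..N} \<Longrightarrow> \<exists>L. L-lipschitz_on (UNIV \<times> A i) (b i)"
    and \<sigma>_lipschitz: "\<And>i. i \<in> {1..N} \<Longrightarrow> \<exists>L. L-lipschitz_on (UNIV \<times> A i) (\<sigma> i)"
    and f_continuous: "\<And>i. i \<in> {1..N} \<Longrightarrow> continuous_on (UNIV \<times> A i) (f i)"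
    and f_growth: "\<And>i. i \<in> {1..N} \<Longrightarrow>
          \<exists>c. \<forall>z \<in> UNIV \<times> A i. \<bar>f i z\<bar> \<le> c * (1 + (norm z)\<^sup>2)"
    and g_continuous: "\<And>i. i \<in> {1..N} \<Longrightarrow> continuous_on UNIV (g i)"
    and g_growth: "\<And>i. i \<in> {1..N} \<Longrightarrow> \<exists>c. \<forall>x. \<bar>g i x\<bar> \<le> c * (1 + (norm x)\<^sup>2)"
    and lam_nonneg: "\<And>i j. i \<in> {1..N} \<Longrightarrow> j \<in> {1..N} \<Longrightarrow> i \<noteq> j \<Longrightarrow> 0 \<le> lam i j"
    and K_continuous: "continuous_on UNIV K"
    and K_bounded: "bounded (range K)"
    and K_symmetric: "\<And>x. K (- x) = K x"
    and K_nonzero: "\<exists>x. K x \<noteq> 0"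
    and state_equation: "\<And>i \<phi>. i \<in> {1..N} \<Longrightarrow> \<phi> \<in> Pol i \<Longrightarrow>
          sde_solution T (\<xi> i) (\<lambda>t x. b i (x, \<phi> (t, x))) (\<lambda>t x. \<sigma> i (x, \<phi> (t, x))) (X i \<phi>)"
begin

definition profiles :: "(nat \<Rightarrow> ('d, 'k) policy) set" where
  "profiles = (\<Pi>\<^sub>E i\<in>{1..N}. Pol i)"

definition J :: "nat \<Rightarrow> (nat \<Rightarrow> ('d, 'k) policy) \<Rightarrow> real" where
  "J i \<phi> = expectation (\<lambda>w.
     (LBINT t:{0..T}. (f i (X i (\<phi> i) t w, \<phi> i (t, X i (\<phi> i) t w)) +
        (\<Sum>j\<in>{1..N} - {i}. lam i j * K (X i (\<phi> i) t w - X j (\<phi> j) t w)))) +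
     g i (X i (\<phi> i) T w))"

definition C :: "nat \<Rightarrow> (nat \<Rightarrow> ('d, 'k) policy) \<Rightarrow> real" where
  "C i \<phi> = expectation (\<lambda>w.
     (LBINT t:{0..T}. f i (X i (\<phi> i) t w, \<phi> i (t, X i (\<phi> i) t w))) + g i (X i (\<phi> i) T w))"

definition Kint :: "nat \<Rightarrow> nat \<Rightarrow> (nat \<Rightarrow> ('d, 'k) policy) \<Rightarrow> real" where
  "Kint i j \<phi> = expectation (\<lambda>w. LBINT t:{0..T}. K (X i (\<phi> i) t w - X j (\<phi> j) t w))"

definition potential :: "(nat \<Rightarrow> real) \<Rightarrow> (nat \<Rightarrow> ('d, 'k) policy) \<Rightarrow> real" where
  "potential p \<phi> = (\<Sum>i\<in>{1..N}. p i * C i \<phi>) +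
     1 / 2 * (\<Sum>i\<in>{1..N}. \<Sum>j\<in>{i<..N}. (p i * lam i j + p j * lam j i) * Kint i j \<phi>)"

definition SC :: "(nat \<Rightarrow> ('d, 'k) policy) \<Rightarrow> real" where
  "SC \<phi> = (\<Sum>i\<in>{1..N}. J i \<phi>)"

definition SC_opt :: real where
  "SC_opt = (INF \<phi>\<in>profiles. SC \<phi>)"

definition InEff :: "(nat \<Rightarrow> ('d, 'k) policy) \<Rightarrow> real" where
  "InEff \<phi> = SC \<phi> / SC_opt"

end

definition gamma_ratios :: "nat \<Rightarrow> (nat \<Rightarrow> nat \<Rightarrow> real) \<Rightarrow> (nat \<Rightarrow> real) \<Rightarrow> real set" where
  "gamma_ratios N lam p =
     {(p i * lam i j + p j * lam j i) / (2 * (lam i j + lam j i)) | i j.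
        1 \<le> i \<and> i < j \<and> j \<le> N \<and> lam i j + lam j i > 0}"

definition gamma_lower :: "nat \<Rightarrow> (nat \<Rightarrow> nat \<Rightarrow> real) \<Rightarrow> (nat \<Rightarrow> real) \<Rightarrow> real" where
  "gamma_lower N lam p = min (Min (p ` {1..N})) (Min (gamma_ratios N lam p))"

definition gamma_upper :: "nat \<Rightarrow> (nat \<Rightarrow> nat \<Rightarrow> real) \<Rightarrow> (nat \<Rightarrow> real) \<Rightarrow> real" where
  "gamma_upper N lam p = max (Max (p ` {1..N})) (Max (gamma_ratios N lam p))"

end

theory Submission
  imports Defs
begin

text \<open>Each coefficient of the potential \<open>\<Phi>\<^sup>p\<close>, written in the nonnegative quantities \<open>C\<^sub>i\<close> and
  \<open>K\<^sub>i\<^sub>j\<close>, lies between \<open>\<gamma>\<^bsub>lower\<^esub>\<close> and \<open>\<gamma>\<^bsub>upper\<^esub>\<close> times the corresponding coefficient of the social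
  cost, so \<open>\<gamma>\<^bsub>lower\<^esub> SC(\<phi>\<^sup>p) \<le> \<Phi>\<^sup>p(\<phi>\<^sup>p) \<le> \<Phi>\<^sup>p(\<phi>) \<le> \<gamma>\<^bsub>upper\<^esub> SC(\<phi>)\<close> for every profile \<open>\<phi>\<close>.
  The analytic part is the identity \<open>J\<^sub>i = C\<^sub>i + \<Sum>\<^sub>j \<lambda>\<^sub>i\<^sub>j K\<^sub>i\<^sub>j\<close>, which needs integrable costs.  As the
  costs grow at most quadratically, a bound on the second moments of the state suffices: an
  Ito-type inequality bounds the second moment of the stochastic integral, and Gronwall's inequality
  for the state minus the stochastic integral does the rest.\<close>

section \<open>Second moments of the Ito integral\<close>

text \<open>Square integrability of the state is not part of \<open>sde_solution\<close>. Gronwall's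
  inequality for the second moment of \<open>X\<close> could therefore start from an infinite
  quantity, and the usual remedy is localisation by stopping times. Here it is applied path by path
  instead: the resulting bound on the squared norm of \<open>X t w\<close> contains only the initial
  value and the path of the stochastic integral \<open>I\<close>. The second moment of
  \<open>I\<close> is finite because \<open>ito_integral\<close> demands a square-integrable
  integrand, so nothing circular remains. Only finiteness matters, so the Ito isometry may be
  weakened to an inequality with the factor \<open>CARD('m)\<close>. The 2 in the denominators of
  \<open>gamma_ratios\<close> has this origin: the social cost meets the interaction of a pair once
  in \<open>J i\<close> and once in \<open>J j\<close>, with total weight
  \<open>lam i j + lam j i\<close>, whereas the potential carries half of
  \<open>p i * lam i j + p j * lam j i\<close>.\<close>

lemma (in prob_space) indep_set_subset:
  assumes "indep_set A B" "A' \<subseteq> A" "B' \<subseteq> B"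
  shows "indep_set A' B'"
  using assms indep_setD_ev1[OF assms(1)] indep_setD_ev2[OF assms(1)] indep_setD[OF assms(1)]
  by (intro indep_setI) blast+

section \<open>Independence of the increments from the augmented filtration\<close>

context brownian_motion
begin

lemma space_brownian_filtration [simp]: "space (brownian_filtration t) = space M"
  unfolding brownian_filtration_def by (auto simp: space_measure_of_conv)

lemma filtration_generators:
  assumes "0 \<le> t"
  shows "{W u -` B \<inter> space M | u B. u \<in> {0..t} \<and> B \<in> sets borel} \<union> null_sets M \<subseteq> events"
  using W_measurable by (auto intro: measurable_sets)

lemma sets_brownian_filtration:
  assumes "0 \<le> t"
  shows "sets (brownian_filtration t) = sigma_sets (space M)
    ({W u -` B \<inter> space M | u B. u \<in> {0..t} \<and> B \<in> sets borel} \<union> null_sets M)"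
  unfolding brownian_filtration_def
  by (rule sets_measure_of[OF subset_trans[OF filtration_generators[OF assms] sets.space_closed]])

lemma brownian_filtration_le_events:
  assumes "0 \<le> t"
  shows "sets (brownian_filtration t) \<subseteq> events"
  unfolding sets_brownian_filtration[OF assms]
  by (rule sets.sigma_sets_subset[OF filtration_generators[OF assms]])

lemma brownian_filtration_measurable_M:
  assumes "0 \<le> t" "Y \<in> measurable (brownian_filtration t) N"
  shows "Y \<in> measurable M N"
  using assms(2) brownian_filtration_le_events[OF assms(1)] unfolding measurable_def by simp blast

lemma brownian_filtration_mono:
  assumes "0 \<le> s" "s \<le> t"
  shows "sets (brownian_filtration s) \<subseteq> sets (brownian_filtration t)"
  unfolding sets_brownian_filtration[OF assms(1)] sets_brownian_filtration[OF order_trans[OF assms]]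
proof (rule sigma_sets_mono', rule Un_mono)
  show "{W u -` B \<inter> space M | u B. u \<in> {0..s} \<and> B \<in> sets borel}
      \<subseteq> {W u -` B \<inter> space M | u B. u \<in> {0..t} \<and> B \<in> sets borel}"
    using assms(2) by (intro subsetI, elim CollectE exE conjE, intro CollectI exI conjI) (assumption | simp)+
qed simp

lemma brownian_filtration_measurable_mono:
  assumes "0 \<le> s" "s \<le> t" "Y \<in> measurable (brownian_filtration s) N"
  shows "Y \<in> measurable (brownian_filtration t) N"
  using assms(3) brownian_filtration_mono[OF assms(1,2)] unfolding measurable_def by simp blast

lemma W_adapted:
  assumes "0 \<le> u" "u \<le> t"
  shows "W u \<in> borel_measurable (brownian_filtration t)"
proof (rule measurableI)
  fix B :: "(real ^ 'm) set" assume "B \<in> sets borel"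
  then show "W u -` B \<inter> space (brownian_filtration t) \<in> sets (brownian_filtration t)"
    unfolding sets_brownian_filtration[OF order_trans[OF assms]] space_brownian_filtration
    using assms by (intro sigma_sets.Basic UnI1 CollectI exI conjI) (auto)
qed simp

text \<open>Adding the null sets to the sigma-algebra of the past leaves a generator that is stable under
  intersections, so that independence of the increments survives the augmentation.\<close>

lemma increment_indep_filtration:
  assumes st: "0 \<le> s" "s < t" and Y: "Y \<in> borel_measurable (brownian_filtration s)"
  shows "indep_var borel Y borel (\<lambda>w. (W t w - W s w) $ a)"
proof -
  define G where "G = {W u -` B \<inter> space M | u B. u \<in> {0..s} \<and> B \<in> sets borel}"
  define D where "D = {(\<lambda>w. W t w - W s w) -` B \<inter> space M | B. B \<in> sets (borel :: (real ^ 'm) measure)}"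
  have ind: "indep_set (sigma_sets (space M) G) D"
    unfolding G_def D_def by (rule W_indep_increments[OF st])
  have G: "sigma_sets (space M) G \<subseteq> events" and D: "D \<subseteq> events"
    using indep_setD_ev1[OF ind] indep_setD_ev2[OF ind] by auto
  \<comment> \<open>For a null set both sides of the product formula are 0, so adjoining the null
    sets to the first family preserves independence.\<close>
  have ind': "indep_set (sigma_sets (space M) G \<union> null_sets M) D"
  proof (rule indep_setI)
    fix x y assume x: "x \<in> sigma_sets (space M) G \<union> null_sets M" and y: "y \<in> D"
    show "prob (x \<inter> y) = prob x * prob y"
    proof (cases "x \<in> null_sets M")
      case True
      then have "x \<inter> y \<in> null_sets M" using y D by (auto intro: null_set_Int2)
      with True show ?thesis by (simp add: measure_eq_0_null_sets)
    next
      case False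
      with x y ind show ?thesis by (auto intro: indep_setD)
    qed
  qed (use G D in auto)
  have stable1: "Int_stable (sigma_sets (space M) G \<union> null_sets M)"
  proof (rule Int_stableI)
    fix x y
    assume x: "x \<in> sigma_sets (space M) G \<union> null_sets M" and y: "y \<in> sigma_sets (space M) G \<union> null_sets M"
    have ev: "x \<in> events" "y \<in> events" using x y G by auto
    interpret S: sigma_algebra "space M" "sigma_sets (space M) G"
      by (rule sigma_algebra_sigma_sets) (auto simp: G_def)
    show "x \<inter> y \<in> sigma_sets (space M) G \<union> null_sets M"
      using x y ev by (auto intro: null_set_Int1 null_set_Int2)
  qed
  have stable2: "Int_stable D"
  proof (rule Int_stableI)
    fix x y assume "x \<in> D" "y \<in> D"
    then obtain B B' where B: "B \<in> sets borel" "B' \<in> sets (borel :: (real ^ 'm) measure)" 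
      "x = (\<lambda>w. W t w - W s w) -` B \<inter> space M" "y = (\<lambda>w. W t w - W s w) -` B' \<inter> space M"
      unfolding D_def by auto
    show "x \<inter> y \<in> D" unfolding D_def mem_Collect_eq using B
      by (intro exI[of _ "B \<inter> B'"]) auto
  qed
  have gen: "sets (brownian_filtration s) \<subseteq> sigma_sets (space M) (sigma_sets (space M) G \<union> null_sets M)"
    unfolding sets_brownian_filtration[OF st(1)] G_def[symmetric] by (intro sigma_sets_mono') auto
  have ind2: "indep_set (sets (brownian_filtration s)) (sigma_sets (space M) D)"
    by (rule indep_set_subset[OF indep_set_sigma_sets[OF ind' stable1 stable2] gen order_refl])
  have Ysets: "sigma_sets (space M) {Y -` B \<inter> space M | B. B \<in> sets borel} \<subseteq> sets (brownian_filtration s)"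
    using sets.sigma_sets_subset[of "{Y -` B \<inter> space M | B. B \<in> sets borel}" "brownian_filtration s"]
      measurable_sets[OF Y] by auto
  \<comment> \<open>Independence is known for the whole vector increment; an event of one component
    is a preimage under a coordinate projection and so already lies in \<open>D\<close>.\<close>
  have Dsets: "sigma_sets (space M) {(\<lambda>w. (W t w - W s w) $ a) -` B \<inter> space M | B. B \<in> sets borel}
      \<subseteq> sigma_sets (space M) D"
  proof (rule sigma_sets_mono', rule subsetI)
    fix x assume "x \<in> {(\<lambda>w. (W t w - W s w) $ a) -` B \<inter> space M | B. B \<in> sets borel}"
    then obtain B where B: "B \<in> sets borel" "x = (\<lambda>w. (W t w - W s w) $ a) -` B \<inter> space M" by auto
    have "(\<lambda>v::real^'m. v $ a) -` B \<inter> space borel \<in> sets borel"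
      by (rule measurable_sets[OF _ B(1)]) measurable
    then show "x \<in> D" unfolding D_def mem_Collect_eq using B(2)
      by (intro exI[of _ "(\<lambda>v. v $ a) -` B"]) auto
  qed
  have meas: "W t \<in> borel_measurable M" "W s \<in> borel_measurable M"
    using W_measurable st by auto
  have "(\<lambda>w. (W t w - W s w) $ a) \<in> borel_measurable M"
    by (rule measurable_compose[OF borel_measurable_diff[OF meas]]) measurable
  then show ?thesis
    unfolding indep_var_eq
    using indep_set_subset[OF ind2 Ysets Dsets] brownian_filtration_measurable_M[OF st(1) Y] by blast
qed

lemma increment_moments:
  assumes "0 \<le> s" "s < t"
  shows "integrable M (\<lambda>w. (W t w - W s w) $ a)" "expectation (\<lambda>w. (W t w - W s w) $ a) = 0"
    "integrable M (\<lambda>w. ((W t w - W s w) $ a)\<^sup>2)" "expectation (\<lambda>w. ((W t w - W s w) $ a)\<^sup>2) = t - s"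
proof -
  note D = W_normal[OF assms, of a]
  have pos: "0 < sqrt (t - s)" using assms by simp
  show E: "expectation (\<lambda>w. (W t w - W s w) $ a) = 0"
    by (rule normal_distributed_expectation[OF pos D])
  have "integrable lborel (\<lambda>x. normal_density 0 (sqrt (t - s)) x * x)"
    using integrable_normal_moment[OF pos, of 0 1] by simp
  then show "integrable M (\<lambda>w. (W t w - W s w) $ a)"
    by (intro distributed_integrable_var[OF D]) (rule normal_density_nonneg)
  have "integrable lborel (\<lambda>x. normal_density 0 (sqrt (t - s)) x * x\<^sup>2)"
    using integrable_normal_moment[OF pos, of 0 2] by simp
  then show "integrable M (\<lambda>w. ((W t w - W s w) $ a)\<^sup>2)"
    by (subst distributed_integrable[OF D, symmetric]) (auto intro: normal_density_nonneg)
  show "expectation (\<lambda>w. ((W t w - W s w) $ a)\<^sup>2) = t - s"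
    using normal_distributed_variance[OF pos D] assms unfolding E by simp
qed

end

section \<open>Frobenius norm bounds for matrix-vector products\<close>

lemma power2_norm_vec: "(norm (v :: 'a :: real_normed_vector ^ 'n))\<^sup>2 = (\<Sum>i\<in>UNIV. (norm (v $ i))\<^sup>2)"
  unfolding norm_vec_def L2_set_def by (simp add: sum_nonneg)

text \<open>Cauchy-Schwarz in each row: the Frobenius norm dominates the operator norm.\<close>

lemma norm_matrix_vector_mult_le:
  fixes A :: "real ^ 'n ^ 'k"
  shows "norm (A *v x) \<le> norm A * norm x"
proof -
  have "(norm (A *v x))\<^sup>2 = (\<Sum>i\<in>UNIV. (A $ i \<bullet> x)\<^sup>2)"
    by (simp add: power2_norm_vec matrix_vector_mult_def inner_vec_def)
  also have "\<dots> \<le> (\<Sum>i\<in>UNIV. (norm (A $ i))\<^sup>2 * (norm x)\<^sup>2)"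
    by (intro sum_mono) (simp add: Cauchy_Schwarz_ineq power2_norm_eq_inner)
  also have "\<dots> = (norm A * norm x)\<^sup>2"
    by (simp add: power_mult_distrib power2_norm_vec[of A] sum_distrib_right)
  finally show ?thesis
    by (rule power2_le_imp_le) simp
qed

lemma measurable_matrix_vector_mult [measurable]:
  fixes A :: "'a \<Rightarrow> real ^ 'n ^ 'k"
  assumes "A \<in> borel_measurable M" "v \<in> borel_measurable M"
  shows "(\<lambda>w. A w *v v w) \<in> borel_measurable M"
  by (rule borel_measurable_continuous_Pair[OF assms])
     (auto intro!: continuous_intros simp: matrix_vector_mult_def)

lemma measurable_transpose_mult:
  fixes A :: "'a \<Rightarrow> real ^ 'n ^ 'k"
  assumes "A \<in> borel_measurable M" "v \<in> borel_measurable M"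
  shows "(\<lambda>w. transpose (A w) *v v w) \<in> borel_measurable M"
  by (rule borel_measurable_continuous_Pair[OF assms])
     (auto intro!: continuous_intros simp: matrix_vector_mult_def transpose_def)

lemma norm_transpose_eq: "norm (transpose (A :: real ^ 'n ^ 'k)) = norm A"
proof -
  have "(norm (transpose A))\<^sup>2 = (\<Sum>i\<in>UNIV. \<Sum>j\<in>UNIV. (A $ j $ i)\<^sup>2)"
    by (simp add: power2_norm_vec transpose_def)
  also have "\<dots> = (\<Sum>j\<in>UNIV. \<Sum>i\<in>UNIV. (A $ j $ i)\<^sup>2)"
    by (rule sum.swap)
  also have "\<dots> = (norm A)\<^sup>2"
    by (simp add: power2_norm_vec)
  finally show ?thesis by simp
qed

lemma norm_add_squared_le:
  fixes x y :: "'a :: real_normed_vector"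
  shows "(norm (x + y))\<^sup>2 \<le> 2 * (norm x)\<^sup>2 + 2 * (norm y)\<^sup>2"
proof -
  have "(norm (x + y))\<^sup>2 \<le> (norm x + norm y)\<^sup>2"
    by (intro power_mono norm_triangle_ineq) simp
  also have "\<dots> \<le> 2 * (norm x)\<^sup>2 + 2 * (norm y)\<^sup>2"
    using zero_le_power2[of "norm x - norm y"] by (simp add: power2_eq_square algebra_simps)
  finally show ?thesis .
qed

section \<open>Second moments of elementary integrals\<close>

context brownian_motion
begin

text \<open>The product is bounded by the norms of its factors before the expectation is taken. What
  is left is a sum over single components of the increment, each independent of
  \<open>\<xi>\<close>, and no product of two different components has to be evaluated. Each
  component contributes \<open>t - s\<close>, whence \<open>CARD('m)\<close> in place of the
  constant 1 of the isometry.\<close>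

lemma integrable_square_times_increment:
  assumes st: "0 \<le> s" "s < t"
    and \<xi>: "\<xi> \<in> borel_measurable (brownian_filtration s)" "\<And>w. w \<in> space M \<Longrightarrow> norm (\<xi> w :: real ^ 'm ^ 'k) \<le> c"
  shows "integrable M (\<lambda>w. (norm (\<xi> w *v (W t w - W s w)))\<^sup>2)" (is "?int")
    "expectation (\<lambda>w. (norm (\<xi> w *v (W t w - W s w)))\<^sup>2)
       \<le> real CARD('m) * (expectation (\<lambda>w. (norm (\<xi> w))\<^sup>2) * (t - s))" (is "?le")
proof -
  have [measurable]: "W t \<in> borel_measurable M" "W s \<in> borel_measurable M"
    using W_measurable st by auto
  note \<xi>M [measurable] = brownian_filtration_measurable_M[OF st(1) \<xi>(1)]
  have \<xi>2: "(\<lambda>w. (norm (\<xi> w))\<^sup>2) \<in> borel_measurable (brownian_filtration s)"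
    using \<xi>(1) by measurable
  have int\<xi>: "integrable M (\<lambda>w. (norm (\<xi> w))\<^sup>2)"
    by (rule integrable_const_bound[where B="c\<^sup>2"]) (auto intro!: power_mono \<xi>(2))
  have ind: "indep_var borel (\<lambda>w. (norm (\<xi> w))\<^sup>2) borel (\<lambda>w. ((W t w - W s w) $ a)\<^sup>2)" for a
    using indep_var_compose[OF increment_indep_filtration[OF st \<xi>2, of a], of "\<lambda>x. x" borel "\<lambda>x. x\<^sup>2" borel]
    by (simp add: comp_def)
  note int = indep_var_integrable[OF ind int\<xi> increment_moments(3)[OF st]]
  note eq = indep_var_lebesgue_integral[OF ind int\<xi> increment_moments(3)[OF st]]
  have bound: "(norm (\<xi> w *v (W t w - W s w)))\<^sup>2 \<le> (\<Sum>a\<in>UNIV. (norm (\<xi> w))\<^sup>2 * ((W t w - W s w) $ a)\<^sup>2)" for w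
  proof -
    have "(norm (\<xi> w *v (W t w - W s w)))\<^sup>2 \<le> (norm (\<xi> w) * norm (W t w - W s w))\<^sup>2"
      by (intro power_mono norm_matrix_vector_mult_le) simp
    also have "\<dots> = (\<Sum>a\<in>UNIV. (norm (\<xi> w))\<^sup>2 * ((W t w - W s w) $ a)\<^sup>2)"
      unfolding power_mult_distrib power2_norm_eq_inner[of "W t w - W s w"] inner_vec_def
      by (simp add: sum_distrib_left power2_eq_square)
    finally show ?thesis .
  qed
  have intS: "integrable M (\<lambda>w. \<Sum>a\<in>UNIV. (norm (\<xi> w))\<^sup>2 * ((W t w - W s w) $ a)\<^sup>2)"
    by (rule Bochner_Integration.integrable_sum[OF int])
  show ?int
    by (rule Bochner_Integration.integrable_bound[OF intS]) (use order_trans[OF bound abs_ge_self] in \<open>auto\<close>)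
  then have "expectation (\<lambda>w. (norm (\<xi> w *v (W t w - W s w)))\<^sup>2)
      \<le> expectation (\<lambda>w. \<Sum>a\<in>UNIV. (norm (\<xi> w))\<^sup>2 * ((W t w - W s w) $ a)\<^sup>2)"
    by (intro integral_mono intS bound)
  also have "\<dots> = (\<Sum>a::'m\<in>UNIV. expectation (\<lambda>w. (norm (\<xi> w))\<^sup>2) * (t - s))"
    by (subst Bochner_Integration.integral_sum[OF int]) (simp only: eq increment_moments(4)[OF st])
  finally show ?le by simp
qed

text \<open>Orthogonality of a new term to the past. Moving \<open>\<xi>\<close> across the inner
  product as a transpose leaves the vector \<open>Y\<close>, known at time \<open>s\<close>, against
  an independent increment of mean 0. Since \<open>\<xi>\<close> is bounded, \<open>Y\<close>
  inherits integrability from \<open>S\<close>.\<close>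

lemma expectation_inner_increment:
  assumes st: "0 \<le> s" "s < t"
    and \<xi>: "\<xi> \<in> borel_measurable (brownian_filtration s)" "\<And>w. w \<in> space M \<Longrightarrow> norm (\<xi> w :: real ^ 'm ^ 'k) \<le> c"
    and S: "S \<in> borel_measurable (brownian_filtration s)" "integrable M (\<lambda>w. (norm (S w))\<^sup>2)"
  shows "integrable M (\<lambda>w. S w \<bullet> (\<xi> w *v (W t w - W s w)))"
    "expectation (\<lambda>w. S w \<bullet> (\<xi> w *v (W t w - W s w))) = 0"
proof -
  define Y where "Y = (\<lambda>w. transpose (\<xi> w) *v S w)"
  have YF: "(\<lambda>w. Y w $ a) \<in> borel_measurable (brownian_filtration s)" for a
    unfolding Y_def by (rule measurable_compose[OF measurable_transpose_mult[OF \<xi>(1) S(1)]]) measurable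
  note YM = brownian_filtration_measurable_M[OF st(1) YF]
  note [measurable] = brownian_filtration_measurable_M[OF st(1) S(1)]
  have intS: "integrable M (\<lambda>w. norm (S w))"
    by (rule square_integrable_imp_integrable[OF _ S(2)]) measurable
  have "norm (Y w $ a) \<le> norm (c * norm (S w))" if "w \<in> space M" for w a
  proof -
    have "norm (Y w $ a) \<le> norm (Y w)" by (simp add: component_le_norm_cart)
    also have "\<dots> \<le> norm (\<xi> w) * norm (S w)"
      unfolding Y_def using norm_matrix_vector_mult_le[of "transpose (\<xi> w)"] by (simp add: norm_transpose_eq)
    also have "\<dots> \<le> c * norm (S w)" by (intro mult_right_mono \<xi>(2) that) simp
    finally show ?thesis by simp
  qed
  then have intY: "integrable M (\<lambda>w. Y w $ a)" for a
    by (intro Bochner_Integration.integrable_bound[OF integrable_mult_right[OF intS, of c] YM]) auto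
  note ind = increment_indep_filtration[OF st YF]
  note int = indep_var_integrable[OF ind intY increment_moments(1)[OF st]]
  note eq = indep_var_lebesgue_integral[OF ind intY increment_moments(1)[OF st]]
  have split: "S w \<bullet> (\<xi> w *v (W t w - W s w)) = (\<Sum>a\<in>UNIV. Y w $ a * (W t w - W s w) $ a)" for w
    unfolding Y_def transpose_matrix_vector dot_lmul_matrix[symmetric]
    by (subst inner_vec_def) simp
  show "integrable M (\<lambda>w. S w \<bullet> (\<xi> w *v (W t w - W s w)))"
    unfolding split by (rule Bochner_Integration.integrable_sum[OF int])
  show "expectation (\<lambda>w. S w \<bullet> (\<xi> w *v (W t w - W s w))) = 0"
    unfolding split by (subst Bochner_Integration.integral_sum[OF int]) (simp only: eq increment_moments(2)[OF st], simp)
qed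

lemma elementary_SucD: "elementary T (Suc n) \<tau> \<xi> \<Longrightarrow> elementary T n \<tau> \<xi>"
  unfolding elementary_def by auto

text \<open>Whatever \<open>t\<close> is, the clipped times \<open>min t (\<tau> k)\<close> do not
  exceed \<open>\<tau> n\<close>. The case \<open>u = \<tau> n\<close> makes the sum of the earlier
  terms independent of the next increment, as the induction below requires.\<close>

lemma elementary_integral_adapted:
  fixes \<xi> :: "nat \<Rightarrow> 'w \<Rightarrow> real ^ 'm ^ 'k"
  assumes "elementary T n \<tau> \<xi>" "0 \<le> t" "\<tau> n \<le> u"
  shows "elementary_integral n \<tau> \<xi> t \<in> borel_measurable (brownian_filtration u)"
proof -
  have mono: "\<tau> k \<le> \<tau> n" if "k \<le> n" for k
    using that
  proof (induction rule: inc_induct)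
    case (step k) then show ?case using assms(1) unfolding elementary_def by (meson less_imp_le order_trans)
  qed simp
  have nonneg: "0 \<le> \<tau> k" if "k \<le> n" for k
    using assms(1) that unfolding elementary_def by auto
  have meas: "\<xi> k \<in> borel_measurable (brownian_filtration u)" if "k < n" for k
    using assms that mono[of k] nonneg[of k]
    by (intro brownian_filtration_measurable_mono[of "\<tau> k" u]) (auto simp: elementary_def)
  have "W (min t (\<tau> k)) \<in> borel_measurable (brownian_filtration u)" if "k \<le> n" for k
    using assms mono[OF that] nonneg[OF that] by (intro W_adapted) auto
  with meas show ?thesis
    unfolding elementary_integral_def
    by (intro borel_measurable_sum measurable_matrix_vector_mult borel_measurable_diff) auto
qed

text \<open>Induction that splits off the last interval: the mixed term has expectation 0 by
  orthogonality, so the second moments add up.\<close>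

lemma elementary_integral_L2:
  fixes \<xi> :: "nat \<Rightarrow> 'w \<Rightarrow> real ^ 'm ^ 'k"
  assumes "elementary T n \<tau> \<xi>" "0 \<le> t"
  shows "integrable M (\<lambda>w. (norm (elementary_integral n \<tau> \<xi> t w))\<^sup>2) \<and>
    expectation (\<lambda>w. (norm (elementary_integral n \<tau> \<xi> t w))\<^sup>2)
      \<le> real CARD('m) * (\<Sum>k<n. expectation (\<lambda>w. (norm (\<xi> k w))\<^sup>2) * (\<tau> (Suc k) - \<tau> k))"
  using assms(1)
proof (induction n)
  case 0
  then show ?case by (simp add: elementary_integral_def)
next
  case (Suc n)
  define S where "S = elementary_integral n \<tau> \<xi> t"
  note IH = Suc.IH[OF elementary_SucD[OF Suc.prems], folded S_def]
  from Suc.prems obtain c where el: "0 \<le> \<tau> n" "\<tau> n < \<tau> (Suc n)"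
      "\<xi> n \<in> borel_measurable (brownian_filtration (\<tau> n))" "\<And>w. w \<in> space M \<Longrightarrow> norm (\<xi> n w) \<le> c"
    unfolding elementary_def by (metis atLeastAtMost_iff le_eq_less_or_eq lessI)
  have nn: "0 \<le> expectation (\<lambda>w. (norm (\<xi> n w))\<^sup>2)" by simp
  have rec: "elementary_integral (Suc n) \<tau> \<xi> t w
      = S w + \<xi> n w *v (W (min t (\<tau> (Suc n))) w - W (min t (\<tau> n)) w)" for w
    unfolding S_def elementary_integral_def by simp
  show ?case
  proof (cases "t \<le> \<tau> n")
    case True
    \<comment> \<open>Both clipped times equal \<open>t\<close>, so the last term vanishes, while
      the bound only gains a nonnegative summand.\<close>
    then have "elementary_integral (Suc n) \<tau> \<xi> t = S"
      using rec el by (auto simp: min_def)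
    moreover have "0 \<le> real CARD('m) * (expectation (\<lambda>w. (norm (\<xi> n w))\<^sup>2) * (\<tau> (Suc n) - \<tau> n))"
      using nn el(2) by (intro mult_nonneg_nonneg) auto
    ultimately show ?thesis
      using IH unfolding sum.lessThan_Suc distrib_left by (auto intro: add_increasing2)
  next
    case False
    \<comment> \<open>The last increment stops at \<open>t\<close> if \<open>t\<close> falls inside
      the interval; its length is then at most the full length occurring in the bound.\<close>
    define r where "r = min t (\<tau> (Suc n))"
    have r: "\<tau> n < r" "r \<le> \<tau> (Suc n)" using False el unfolding r_def by auto
    define Z where "Z w = \<xi> n w *v (W r w - W (\<tau> n) w)" for w
    have rec': "elementary_integral (Suc n) \<tau> \<xi> t w = S w + Z w" for w
      using False rec unfolding Z_def r_def by simp
    have SF: "S \<in> borel_measurable (brownian_filtration (\<tau> n))"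
      unfolding S_def by (rule elementary_integral_adapted[OF elementary_SucD[OF Suc.prems] assms(2) order_refl])
    note Z = integrable_square_times_increment[OF el(1) r(1) el(3,4), folded Z_def]
    note SZ = expectation_inner_increment[OF el(1) r(1) el(3,4) SF conjunct1[OF IH], folded Z_def]
    have sq: "(norm (S w + Z w))\<^sup>2 = (norm (S w))\<^sup>2 + 2 * (S w \<bullet> Z w) + (norm (Z w))\<^sup>2" for w
      by (simp add: power2_norm_eq_inner inner_add_left inner_add_right inner_commute)
    have int: "integrable M (\<lambda>w. (norm (S w + Z w))\<^sup>2)"
      unfolding sq using IH SZ Z by (intro Bochner_Integration.integrable_add integrable_mult_right) auto
    have "expectation (\<lambda>w. (norm (S w + Z w))\<^sup>2)
        = expectation (\<lambda>w. (norm (S w))\<^sup>2) + expectation (\<lambda>w. (norm (Z w))\<^sup>2)"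
      unfolding sq using IH SZ Z by (simp)
    also have "expectation (\<lambda>w. (norm (Z w))\<^sup>2)
        \<le> real CARD('m) * (expectation (\<lambda>w. (norm (\<xi> n w))\<^sup>2) * (\<tau> (Suc n) - \<tau> n))"
      using r by (intro order_trans[OF Z(2)] mult_left_mono) auto
    finally show ?thesis
      unfolding rec' using int IH by (simp add: algebra_simps)
  qed
qed


text \<open>The half-open intervals are disjoint, so at each \<open>t\<close> at most one summand is
  nonzero and the square of the sum is the sum of the squares.\<close>

lemma power2_norm_elementary_process:
  fixes \<xi> :: "nat \<Rightarrow> 'w \<Rightarrow> real ^ 'm ^ 'k"
  assumes "elementary T n \<tau> \<xi>"
  shows "ennreal ((norm (elementary_process n \<tau> \<xi> t w))\<^sup>2) =
    (\<Sum>k<n. ennreal ((norm (\<xi> k w))\<^sup>2) * indicator {\<tau> k<..\<tau> (Suc k)} t)"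
  using assms
proof (induction n)
  case 0
  then show ?case by (simp add: elementary_process_def)
next
  case (Suc n)
  note IH = Suc.IH[OF elementary_SucD[OF Suc.prems]]
  have rec: "elementary_process (Suc n) \<tau> \<xi> t w = elementary_process n \<tau> \<xi> t w
      + (if \<tau> n < t \<and> t \<le> \<tau> (Suc n) then \<xi> n w else 0)"
    unfolding elementary_process_def by simp
  show ?case
  proof (cases "\<tau> n < t")
    case True
    have "\<tau> (Suc k) \<le> \<tau> n" if "k < n" for k
      using Suc_leI[OF that]
    proof (induction rule: inc_induct)
      case (step k) then show ?case using Suc.prems unfolding elementary_def by (meson less_SucI less_imp_le order_trans)
    qed simp
    with True have "elementary_process n \<tau> \<xi> t w = 0"
      unfolding elementary_process_def by (intro sum.neutral) force
    with IH show ?thesis unfolding rec by auto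
  next
    case False
    then show ?thesis unfolding rec using IH by simp
  qed
qed

text \<open>Identifies the sum in \<open>elementary_integral_L2\<close> with the squared norm of the
  integrand in the sense of \<open>ito_integral\<close>. For fixed \<open>w\<close> the time
  integral is a finite sum of interval lengths, so the expectation can be taken term by
  term.\<close>

lemma nn_integral_elementary_process:
  fixes \<xi> :: "nat \<Rightarrow> 'w \<Rightarrow> real ^ 'm ^ 'k"
  assumes el: "elementary T n \<tau> \<xi>"
  shows "(\<integral>\<^sup>+ w. (\<integral>\<^sup>+ t\<in>{0..T}. ennreal ((norm (elementary_process n \<tau> \<xi> t w))\<^sup>2) \<partial>lborel) \<partial>M)
    = ennreal (\<Sum>k<n. expectation (\<lambda>w. (norm (\<xi> k w))\<^sup>2) * (\<tau> (Suc k) - \<tau> k))"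
proof -
  have \<tau>: "0 \<le> \<tau> k" "\<tau> k < \<tau> (Suc k)" "\<tau> (Suc k) \<le> T" if "k < n" for k
    using el that unfolding elementary_def by auto
  have \<xi>M: "\<xi> k \<in> borel_measurable M" if "k < n" for k
    using el that by (intro brownian_filtration_measurable_M[OF \<tau>(1)[OF that]]) (auto simp: elementary_def)
  have int: "integrable M (\<lambda>w. (norm (\<xi> k w))\<^sup>2)" if k: "k < n" for k
  proof -
    obtain c where "\<And>w. w \<in> space M \<Longrightarrow> norm (\<xi> k w) \<le> c"
      using el k unfolding elementary_def by blast
    then show ?thesis
      using \<xi>M[OF k] by (intro integrable_const_bound[where B="c\<^sup>2"]) (auto intro!: power_mono)
  qed
  have "(\<integral>\<^sup>+ t\<in>{0..T}. ennreal ((norm (elementary_process n \<tau> \<xi> t w))\<^sup>2) \<partial>lborel)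
      = (\<Sum>k<n. ennreal ((norm (\<xi> k w))\<^sup>2) * ennreal (\<tau> (Suc k) - \<tau> k))" for w
  proof -
    have "(\<integral>\<^sup>+ t\<in>{0..T}. ennreal ((norm (elementary_process n \<tau> \<xi> t w))\<^sup>2) \<partial>lborel)
      = (\<integral>\<^sup>+ t. (\<Sum>k<n. ennreal ((norm (\<xi> k w))\<^sup>2) * indicator {\<tau> k<..\<tau> (Suc k)} t) \<partial>lborel)"
    proof (rule nn_integral_cong)
      fix t
      show "ennreal ((norm (elementary_process n \<tau> \<xi> t w))\<^sup>2) * indicator {0..T} t
        = (\<Sum>k<n. ennreal ((norm (\<xi> k w))\<^sup>2) * indicator {\<tau> k<..\<tau> (Suc k)} t)"
        unfolding power2_norm_elementary_process[OF el] sum_distrib_right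
      proof (rule sum.cong)
        fix k assume "k \<in> {..<n}"
        then show "ennreal ((norm (\<xi> k w))\<^sup>2) * indicator {\<tau> k<..\<tau> (Suc k)} t * indicator {0..T} t
            = ennreal ((norm (\<xi> k w))\<^sup>2) * indicator {\<tau> k<..\<tau> (Suc k)} t"
          using \<tau>[of k] by (auto simp: indicator_def)
      qed simp
    qed
    also have "\<dots> = (\<Sum>k<n. ennreal ((norm (\<xi> k w))\<^sup>2) * ennreal (\<tau> (Suc k) - \<tau> k))"
      by (subst nn_integral_sum) (auto simp: nn_integral_cmult_indicator intro!: sum.cong dest: \<tau>)
    finally show ?thesis .
  qed
  then have "(\<integral>\<^sup>+ w. (\<integral>\<^sup>+ t\<in>{0..T}. ennreal ((norm (elementary_process n \<tau> \<xi> t w))\<^sup>2) \<partial>lborel) \<partial>M)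
    = (\<integral>\<^sup>+ w. (\<Sum>k<n. ennreal ((norm (\<xi> k w))\<^sup>2) * ennreal (\<tau> (Suc k) - \<tau> k)) \<partial>M)"
    by simp
  also have "\<dots> = (\<Sum>k<n. \<integral>\<^sup>+ w. ennreal ((norm (\<xi> k w))\<^sup>2) * ennreal (\<tau> (Suc k) - \<tau> k) \<partial>M)"
    using \<xi>M by (intro nn_integral_sum) auto
  also have "\<dots> = (\<Sum>k<n. ennreal (expectation (\<lambda>w. (norm (\<xi> k w))\<^sup>2) * (\<tau> (Suc k) - \<tau> k)))"
  proof (rule sum.cong)
    fix k assume "k \<in> {..<n}"
    then have k: "k < n" by simp
    show "(\<integral>\<^sup>+ w. ennreal ((norm (\<xi> k w))\<^sup>2) * ennreal (\<tau> (Suc k) - \<tau> k) \<partial>M)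
        = ennreal (expectation (\<lambda>w. (norm (\<xi> k w))\<^sup>2) * (\<tau> (Suc k) - \<tau> k))"
      using \<xi>M[OF k] \<tau>(2)[OF k]
      by (subst nn_integral_multc) (auto simp: nn_integral_eq_integral[OF int[OF k]] ennreal_mult)
  qed simp
  also have "\<dots> = ennreal (\<Sum>k<n. expectation (\<lambda>w. (norm (\<xi> k w))\<^sup>2) * (\<tau> (Suc k) - \<tau> k))"
    using \<tau> by (intro sum_ennreal mult_nonneg_nonneg) (auto simp: less_imp_le)
  finally show ?thesis .
qed

lemma elementary_integral_L2_le:
  fixes \<xi> :: "nat \<Rightarrow> 'w \<Rightarrow> real ^ 'm ^ 'k"
  assumes el: "elementary T n \<tau> \<xi>" and t: "0 \<le> t"
  shows "(\<integral>\<^sup>+ w. ennreal ((norm (elementary_integral n \<tau> \<xi> t w))\<^sup>2) \<partial>M) \<le> ennreal (real CARD('m)) *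
    (\<integral>\<^sup>+ w. (\<integral>\<^sup>+ t\<in>{0..T}. ennreal ((norm (elementary_process n \<tau> \<xi> t w))\<^sup>2) \<partial>lborel) \<partial>M)"
proof -
  have "0 \<le> (\<Sum>k<n. expectation (\<lambda>w. (norm (\<xi> k w))\<^sup>2) * (\<tau> (Suc k) - \<tau> k))"
    using el unfolding elementary_def by (intro sum_nonneg mult_nonneg_nonneg) (auto simp: less_imp_le)
  then show ?thesis
    using elementary_integral_L2[OF el t]
    by (simp add: nn_integral_elementary_process[OF el] nn_integral_eq_integral ennreal_mult[symmetric])
qed

section \<open>Tonelli on the time-probability product and passage to the Ito integral\<close>

text \<open>The restriction to \<open>{0..T}\<close> is essential: \<open>progressive T\<close> says
  nothing about a process at other times, so joint measurability is available on this rectangle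
  only.\<close>

definition time_space :: "real \<Rightarrow> (real \<times> 'w) measure" where
  "time_space T = restrict_space (lborel \<Otimes>\<^sub>M M) ({0..T} \<times> space M)"

lemma space_time_space: "space (time_space T) = {0..T} \<times> space M"
  unfolding time_space_def by (auto simp: space_restrict_space space_pair_measure)

lemma time_space_set: "{0..T :: real} \<times> space M \<in> sets (lborel \<Otimes>\<^sub>M M)"
  by (intro pair_measureI) auto

lemma measurable_time_space_fst: "fst \<in> measurable (time_space T) borel"
  unfolding time_space_def by (intro measurable_restrict_space1) measurable

lemma measurable_time_space_snd: "snd \<in> measurable (time_space T) M"
  unfolding time_space_def by (intro measurable_restrict_space1) measurable

text \<open>The clause of \<open>progressive\<close> at the final time gives joint measurability for
  the filtration at \<open>T\<close>, which is coarser than \<open>M\<close>; composition with the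
  identity transfers it.\<close>

lemma progressive_measurable:
  assumes "0 \<le> T" "progressive T H"
  shows "(\<lambda>(t, w). H t w) \<in> borel_measurable (time_space T)"
proof -
  have "(\<lambda>z. z) \<in> measurable (time_space T) (restrict_space borel {0..T} \<Otimes>\<^sub>M brownian_filtration T)"
  proof (rule measurable_pair)
    show "fst \<circ> (\<lambda>z. z) \<in> measurable (time_space T) (restrict_space borel {0..T})"
      unfolding comp_def
      by (rule measurable_restrict_space2) (use measurable_time_space_fst in \<open>auto simp: space_time_space\<close>)
    have "(\<lambda>w. w) \<in> measurable M (brownian_filtration T)"
      using brownian_filtration_le_events[OF assms(1)] sets.sets_into_space unfolding measurable_def
      by simp blast
    then show "snd \<circ> (\<lambda>z. z) \<in> measurable (time_space T) (brownian_filtration T)"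
      unfolding comp_def by (rule measurable_compose[OF measurable_time_space_snd])
  qed
  moreover have "(\<lambda>(t, w). H t w) \<in> borel_measurable (restrict_space borel {0..T} \<Otimes>\<^sub>M brownian_filtration T)"
    using assms unfolding progressive_def by auto
  ultimately show ?thesis
    by (rule measurable_compose)
qed

lemma nn_integral_time_space:
  assumes F: "F \<in> borel_measurable (time_space T)"
  shows "(\<integral>\<^sup>+ w. (\<integral>\<^sup>+ t\<in>{0..T}. F (t, w) \<partial>lborel) \<partial>M) = (\<integral>\<^sup>+ z. F z \<partial>time_space T)"
    "(\<integral>\<^sup>+ t\<in>{0..T}. (\<integral>\<^sup>+ w. F (t, w) \<partial>M) \<partial>lborel) = (\<integral>\<^sup>+ z. F z \<partial>time_space T)"
proof -
  interpret P: pair_sigma_finite lborel M ..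
  have meas: "(\<lambda>z. F z * indicator ({0..T} \<times> space M) z) \<in> borel_measurable (lborel \<Otimes>\<^sub>M M)"
    using F unfolding time_space_def
    by (subst (asm) borel_measurable_restrict_space_iff_ennreal) (use time_space_set in auto)
  have eq: "(\<integral>\<^sup>+ z. F z \<partial>time_space T) = (\<integral>\<^sup>+ z. F z * indicator ({0..T} \<times> space M) z \<partial>(lborel \<Otimes>\<^sub>M M))"
    unfolding time_space_def using time_space_set by (subst nn_integral_restrict_space) auto
  show "(\<integral>\<^sup>+ w. (\<integral>\<^sup>+ t\<in>{0..T}. F (t, w) \<partial>lborel) \<partial>M) = (\<integral>\<^sup>+ z. F z \<partial>time_space T)"
    unfolding eq P.nn_integral_snd[OF meas, symmetric]
    by (intro nn_integral_cong) (auto simp: indicator_def)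
  show "(\<integral>\<^sup>+ t\<in>{0..T}. (\<integral>\<^sup>+ w. F (t, w) \<partial>M) \<partial>lborel) = (\<integral>\<^sup>+ z. F z \<partial>time_space T)"
    unfolding eq nn_integral_fst[OF meas, symmetric]
    by (intro nn_integral_cong, rule trans[OF _ nn_integral_cong]) (auto simp: indicator_def)
qed

lemma elementary_process_measurable:
  fixes \<xi> :: "nat \<Rightarrow> 'w \<Rightarrow> real ^ 'm ^ 'k"
  assumes "elementary T n \<tau> \<xi>"
  shows "(\<lambda>(t, w). elementary_process n \<tau> \<xi> t w) \<in> borel_measurable (time_space T)"
proof -
  have "\<xi> k \<in> borel_measurable M" if "k < n" for k
    using assms that by (intro brownian_filtration_measurable_M[of "\<tau> k"]) (auto simp: elementary_def)
  note [measurable] = measurable_compose[OF measurable_time_space_snd this] measurable_time_space_fst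
  show ?thesis
    unfolding elementary_process_def split_beta by (intro borel_measurable_sum) measurable
qed

text \<open>No limit of norms is computed: one elementary approximation within distance 1 of both
  \<open>H\<close> and \<open>I t\<close> suffices, by two uses of the inequality \<open>sq\<close>
  around the bound for elementary integrals.\<close>

lemma ito_integral_L2_bounded:
  fixes H :: "real \<Rightarrow> 'w \<Rightarrow> real ^ 'm ^ 'k"
  assumes T: "0 \<le> T" and I: "ito_integral T H I"
  obtains c :: ennreal where "c < \<infinity>" "\<And>t. t \<in> {0..T} \<Longrightarrow> (\<integral>\<^sup>+ w. ennreal ((norm (I t w))\<^sup>2) \<partial>M) \<le> c"
proof -
  from I obtain n \<tau> \<xi> where H: "progressive T H"
      "(\<integral>\<^sup>+ w. (\<integral>\<^sup>+ t\<in>{0..T}. ennreal ((norm (H t w))\<^sup>2) \<partial>lborel) \<partial>M) < \<infinity>"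
    and Ip: "progressive T I"
    and el: "\<And>l. elementary T (n l) (\<tau> l) (\<xi> l)"
    and limH: "((\<lambda>l::nat. \<integral>\<^sup>+ w. (\<integral>\<^sup>+ t\<in>{0..T}.
            ennreal ((norm (elementary_process (n l) (\<tau> l) (\<xi> l) t w - H t w))\<^sup>2) \<partial>lborel) \<partial>M)
          \<longlonglongrightarrow> 0)"
    and limI: "\<And>t. t\<in>{0..T} \<Longrightarrow> (\<lambda>l. \<integral>\<^sup>+ w.
            ennreal ((norm (elementary_integral (n l) (\<tau> l) (\<xi> l) t w - I t w))\<^sup>2) \<partial>M)
          \<longlonglongrightarrow> 0"
    unfolding ito_integral_def by blast
  define h where "h = (\<integral>\<^sup>+ w. (\<integral>\<^sup>+ t\<in>{0..T}. ennreal ((norm (H t w))\<^sup>2) \<partial>lborel) \<partial>M)"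
  define m where "m = ennreal (real CARD('m))"
  \<comment> \<open>\<open>2 + 2 * h\<close> bounds the approximating integrand, the factor
    \<open>m\<close> passes to its integral, and the outer doubling with the final 2 passes to
    \<open>I t\<close>.\<close>
  define c where "c = 2 * (m * (2 + 2 * h)) + 2"
  have sq: "ennreal ((norm x)\<^sup>2) \<le> 2 * ennreal ((norm y)\<^sup>2) + 2 * ennreal ((norm (y - x))\<^sup>2)" for x y :: "'c::real_normed_vector"
  proof -
    have "(norm x)\<^sup>2 \<le> 2 * (norm y)\<^sup>2 + 2 * (norm (y - x))\<^sup>2"
      using norm_add_squared_le[of y "x - y"] by (simp add: norm_minus_commute)
    from ennreal_leI[OF this] show ?thesis
      by (simp add: ennreal_mult)
  qed
  note Hm = progressive_measurable[OF T H(1)]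
  have "(\<integral>\<^sup>+ w. ennreal ((norm (I t w))\<^sup>2) \<partial>M) \<le> c" if t: "t \<in> {0..T}" for t
  proof -
    \<comment> \<open>The index \<open>l\<close> obtained from this may depend on \<open>t\<close>,
      but \<open>c\<close> does not, so the bound is uniform in time.\<close>
    have "eventually (\<lambda>l. (\<integral>\<^sup>+ w. (\<integral>\<^sup>+ t\<in>{0..T}.
            ennreal ((norm (elementary_process (n l) (\<tau> l) (\<xi> l) t w - H t w))\<^sup>2) \<partial>lborel) \<partial>M) < 1 \<and>
        (\<integral>\<^sup>+ w. ennreal ((norm (elementary_integral (n l) (\<tau> l) (\<xi> l) t w - I t w))\<^sup>2) \<partial>M) < 1) sequentially"
      by (intro eventually_conj order_tendstoD(2)[OF limH] order_tendstoD(2)[OF limI[OF t]]) simp_all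
    then obtain l where l: "(\<integral>\<^sup>+ w. (\<integral>\<^sup>+ t\<in>{0..T}.
            ennreal ((norm (elementary_process (n l) (\<tau> l) (\<xi> l) t w - H t w))\<^sup>2) \<partial>lborel) \<partial>M) < 1"
        "(\<integral>\<^sup>+ w. ennreal ((norm (elementary_integral (n l) (\<tau> l) (\<xi> l) t w - I t w))\<^sup>2) \<partial>M) < 1"
      by (metis (no_types, lifting) eventually_sequentially order_refl)
    define P where "P = (\<lambda>t w. elementary_process (n l) (\<tau> l) (\<xi> l) t w)"
    define E where "E = elementary_integral (n l) (\<tau> l) (\<xi> l) t"
    note Pm = elementary_process_measurable[OF el[of l], folded P_def]
    have PH: "(\<lambda>(t, w). P t w - H t w) \<in> borel_measurable (time_space T)"
      using borel_measurable_diff[OF Pm Hm] by (simp add: split_beta)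
    have Pn: "(\<lambda>(t, w). ennreal ((norm (P t w))\<^sup>2)) \<in> borel_measurable (time_space T)"
      and Hn: "(\<lambda>(t, w). ennreal ((norm (H t w))\<^sup>2)) \<in> borel_measurable (time_space T)"
      and PHn: "(\<lambda>(t, w). ennreal ((norm (P t w - H t w))\<^sup>2)) \<in> borel_measurable (time_space T)"
      using Pm Hm PH unfolding split_beta by measurable
    have "(\<integral>\<^sup>+ z. ennreal ((norm (P (fst z) (snd z)))\<^sup>2) \<partial>time_space T)
        \<le> (\<integral>\<^sup>+ z. 2 * ennreal ((norm (H (fst z) (snd z)))\<^sup>2)
              + 2 * ennreal ((norm (P (fst z) (snd z) - H (fst z) (snd z)))\<^sup>2) \<partial>time_space T)"
      by (intro nn_integral_mono) (metis sq norm_minus_commute)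
    also have "\<dots> = 2 * (\<integral>\<^sup>+ z. ennreal ((norm (H (fst z) (snd z)))\<^sup>2) \<partial>time_space T)
        + 2 * (\<integral>\<^sup>+ z. ennreal ((norm (P (fst z) (snd z) - H (fst z) (snd z)))\<^sup>2) \<partial>time_space T)"
      using Hn PHn unfolding split_beta by (simp add: nn_integral_add nn_integral_cmult)
    also have "(\<integral>\<^sup>+ z. ennreal ((norm (H (fst z) (snd z)))\<^sup>2) \<partial>time_space T) = h"
      using nn_integral_time_space(1)[OF Hn] unfolding h_def by (simp add: split_beta)
    also have "(\<integral>\<^sup>+ z. ennreal ((norm (P (fst z) (snd z) - H (fst z) (snd z)))\<^sup>2) \<partial>time_space T) \<le> 1"
      using nn_integral_time_space(1)[OF PHn] l(1) unfolding P_def[symmetric] by (simp add: split_beta)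
    finally have Ple: "(\<integral>\<^sup>+ w. (\<integral>\<^sup>+ t\<in>{0..T}. ennreal ((norm (P t w))\<^sup>2) \<partial>lborel) \<partial>M) \<le> 2 + 2 * h"
      using nn_integral_time_space(1)[OF Pn] by (simp add: split_beta add.commute mult_left_mono)
    have Eint: "(\<integral>\<^sup>+ w. ennreal ((norm (E w))\<^sup>2) \<partial>M) \<le> m * (2 + 2 * h)"
      unfolding m_def using t elementary_integral_L2_le[OF el[of l], of t]
      by (auto simp: E_def intro: order_trans intro!: mult_left_mono Ple[unfolded P_def])
    have Em: "E \<in> borel_measurable M"
      unfolding E_def using el[of l] t
      by (intro brownian_filtration_measurable_M[OF _ elementary_integral_adapted[OF el[of l] _ order_refl]])
        (auto simp: elementary_def)
    have "Pair t \<in> measurable M (time_space T)"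
      unfolding time_space_def using t by (intro measurable_restrict_space2) (auto simp: space_pair_measure)
    from measurable_compose[OF this progressive_measurable[OF T Ip]]
    have Im: "I t \<in> borel_measurable M" by simp
    have "(\<integral>\<^sup>+ w. ennreal ((norm (I t w))\<^sup>2) \<partial>M)
       \<le> (\<integral>\<^sup>+ w. 2 * ennreal ((norm (E w))\<^sup>2) + 2 * ennreal ((norm (E w - I t w))\<^sup>2) \<partial>M)"
      by (intro nn_integral_mono sq)
    also have "\<dots> = 2 * (\<integral>\<^sup>+ w. ennreal ((norm (E w))\<^sup>2) \<partial>M) + 2 * (\<integral>\<^sup>+ w. ennreal ((norm (E w - I t w))\<^sup>2) \<partial>M)"
      using Em Im by (simp add: nn_integral_add nn_integral_cmult)
    also have "\<dots> \<le> 2 * (m * (2 + 2 * h)) + 2 * 1"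
      using Eint l(2) unfolding E_def[symmetric] by (intro add_mono mult_left_mono) (auto simp: less_imp_le)
    finally show ?thesis unfolding c_def by simp
  qed
  moreover have "c < \<infinity>"
    using H(2) unfolding c_def m_def h_def[symmetric] by (simp add: ennreal_mult_less_top)
  ultimately show thesis using that by blast
qed

end


section \<open>Second moments of solutions\<close>

text \<open>Gronwall's argument for \<open>\<bar>x - i\<bar>\<^sup>2\<close>, which is differentiable although \<open>x\<close> need not be.\<close>

lemma norm_squared_le_of_integral_equation:
  fixes x i \<beta> :: "real \<Rightarrow> 'a :: euclidean_space"
  assumes B: "0 \<le> B" and cont: "continuous_on {0..T} i" "continuous_on {0..T} \<beta>"
    and eq: "\<And>t. t \<in> {0..T} \<Longrightarrow> x t = x0 + integral {0..t} \<beta> + i t"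
    and growth: "\<And>t. t \<in> {0..T} \<Longrightarrow> norm (\<beta> t) \<le> B * (1 + norm (x t))"
    and t: "t \<in> {0..T}"
  shows "(norm (x t))\<^sup>2 \<le> 2 * exp (3 * B * T) * ((norm x0)\<^sup>2 + 2 * B * integral {0..T} (\<lambda>s. 1 + (norm (i s))\<^sup>2))
    + 2 * (norm (i t))\<^sup>2"
proof -
  define D where "D = (\<lambda>t. x0 + integral {0..t} \<beta>)"
  define y where "y = (\<lambda>t. D t \<bullet> D t)"
  define q where "q = (\<lambda>s. 1 + (norm (i s))\<^sup>2)"
  \<comment> \<open>The integrating factor makes \<open>h\<close> nonincreasing: the derivative of
    \<open>y\<close> is at most \<open>3 * B * y + 2 * B * q\<close>. The weight cancels the first
    summand and the subtracted integral absorbs the second.\<close>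
  define h where "h = (\<lambda>t. exp (- (3 * B) * t) * y t - 2 * B * integral {0..t} q)"
  have q: "continuous_on {0..T} q" unfolding q_def by (intro continuous_intros cont)
  have dh: "(h has_real_derivative (exp (- (3 * B) * s) * (2 * (D s \<bullet> \<beta> s) - 3 * B * y s) - 2 * B * q s))
      (at s within {0..T})" if s: "s \<in> {0..T}" for s
  proof -
    have dD: "(D has_vector_derivative \<beta> s) (at s within {0..T})"
      unfolding D_def using integral_has_vector_derivative[OF cont(2) s]
      by (auto intro!: derivative_eq_intros)
    have "(y has_real_derivative 2 * (D s \<bullet> \<beta> s)) (at s within {0..T})"
      unfolding y_def has_field_derivative_def
      using has_derivative_inner[OF dD[unfolded has_vector_derivative_def] dD[unfolded has_vector_derivative_def]]
      by (rule has_derivative_eq_rhs) (auto simp: inner_commute)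
    then show ?thesis
      unfolding h_def
      by (auto intro!: derivative_eq_intros integral_has_real_derivative[OF q s] simp: algebra_simps)
  qed
  have le0: "exp (- (3 * B) * s) * (2 * (D s \<bullet> \<beta> s) - 3 * B * y s) - 2 * B * q s \<le> 0" if s: "s \<in> {0..T}" for s
  proof -
    define d where "d = norm (D s)"
    define e where "e = norm (i s)"
    have "norm (x s) \<le> d + e"
      unfolding d_def e_def D_def eq[OF s] by (rule norm_triangle_ineq)
    then have "norm (\<beta> s) \<le> B * (1 + (d + e))"
      using growth[OF s] B by (meson add_left_mono mult_left_mono order_trans)
    then have "d * norm (\<beta> s) \<le> d * (B * (1 + (d + e)))"
      unfolding d_def by (intro mult_left_mono) auto
    then have "2 * (D s \<bullet> \<beta> s) \<le> 2 * (d * (B * (1 + (d + e))))"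
      using norm_cauchy_schwarz[of "D s" "\<beta> s"] unfolding d_def by linarith
    also have "\<dots> \<le> B * (3 * d\<^sup>2 + 2 * (1 + e\<^sup>2))"
    proof -
      \<comment> \<open>Origin of the constants 3 and 2: \<open>2 * d * (1 + e)\<close> is at most
        the sum of the squares of \<open>d\<close> and \<open>1 + e\<close>, and the latter square
        is at most \<open>2 * (1 + e\<^sup>2)\<close>.\<close>
      have "2 * (d * (1 + (d + e))) \<le> 3 * d\<^sup>2 + 2 * (1 + e\<^sup>2)"
        using zero_le_power2[of "d - (1 + e)"] zero_le_power2[of "1 - e"]
        by (simp add: power2_eq_square algebra_simps)
      from mult_left_mono[OF this B] show ?thesis by (simp add: algebra_simps)
    qed
    finally have 1: "2 * (D s \<bullet> \<beta> s) - 3 * B * y s \<le> 2 * B * q s"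
      unfolding y_def q_def d_def e_def by (simp add: power2_norm_eq_inner algebra_simps)
    have "exp (- (3 * B) * s) * (2 * (D s \<bullet> \<beta> s) - 3 * B * y s) \<le> exp (- (3 * B) * s) * (2 * B * q s)"
      by (intro mult_left_mono 1) simp
    also have "\<dots> \<le> 1 * (2 * B * q s)"
      using B s by (intro mult_right_mono) (auto simp: q_def)
    finally show ?thesis by simp
  qed
  have hC: "continuous_on {0..T} h"
    by (rule DERIV_continuous_on) (rule dh)
  have ht: "h t \<le> h 0"
  proof (rule DERIV_nonpos_imp_decreasing_open[where f = h])
    show "continuous_on {0..t} h"
      by (rule continuous_on_subset[OF hC]) (use t in auto)
    fix s assume "0 < s" "s < t"
    then have "s \<in> {0<..<T}" using t by auto
    with dh[of s] le0[of s] show "\<exists>d. (h has_real_derivative d) (at s) \<and> d \<le> 0"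
      by (auto simp: at_within_Icc_at)
  qed (use t in auto)
  have qmono: "integral {0..t} q \<le> integral {0..T} q"
    using t by (intro integral_subset_le integrable_continuous_real continuous_on_subset[OF q])
      (auto simp: q_def)
  have "exp (- (3 * B) * t) * y t \<le> (norm x0)\<^sup>2 + 2 * B * integral {0..t} q"
    using ht unfolding h_def y_def D_def by (simp add: power2_norm_eq_inner)
  also have "\<dots> \<le> (norm x0)\<^sup>2 + 2 * B * integral {0..T} q"
    using B by (intro add_left_mono mult_left_mono qmono) auto
  finally have "exp (3 * B * t) * (exp (- (3 * B) * t) * y t)
      \<le> exp (3 * B * t) * ((norm x0)\<^sup>2 + 2 * B * integral {0..T} q)"
    by (intro mult_left_mono) auto
  also have "exp (3 * B * t) * (exp (- (3 * B) * t) * y t) = y t"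
    by (simp add: mult.assoc[symmetric] exp_add[symmetric])
  \<comment> \<open>Replacing \<open>t\<close> by \<open>T\<close> makes the constant uniform in
    time; this needs the bracket to be nonnegative.\<close>
  also have "exp (3 * B * t) * ((norm x0)\<^sup>2 + 2 * B * integral {0..T} q)
      \<le> exp (3 * B * T) * ((norm x0)\<^sup>2 + 2 * B * integral {0..T} q)"
  proof (intro mult_right_mono)
    show "0 \<le> (norm x0)\<^sup>2 + 2 * B * integral {0..T} q"
      using B by (intro add_nonneg_nonneg mult_nonneg_nonneg integral_nonneg integrable_continuous_real q)
        (auto simp: q_def)
  qed (use t B in \<open>auto intro: mult_left_mono\<close>)
  finally have "y t \<le> exp (3 * B * T) * ((norm x0)\<^sup>2 + 2 * B * integral {0..T} q)" .
  moreover have "(norm (x t))\<^sup>2 \<le> 2 * y t + 2 * (norm (i t))\<^sup>2"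
    using norm_add_squared_le[of "D t" "i t"] eq[OF t] unfolding D_def y_def
    by (simp add: power2_norm_eq_inner)
  ultimately show ?thesis unfolding q_def by simp
qed

section \<open>From pathwise bounds to moments of the state\<close>

context brownian_motion
begin

lemma measurable_section_time_space:
  assumes "F \<in> borel_measurable (time_space T)" "t \<in> {0..T}"
  shows "(\<lambda>w. F (t, w)) \<in> borel_measurable M"
proof -
  have "Pair t \<in> measurable M (time_space T)"
    unfolding time_space_def using assms(2) by (intro measurable_restrict_space2) (auto simp: space_pair_measure)
  from measurable_compose[OF this assms(1)] show ?thesis .
qed

lemma measurable_nn_integral_time:
  assumes F: "F \<in> borel_measurable (time_space T)"
  shows "(\<lambda>w. \<integral>\<^sup>+ t\<in>{0..T}. F (t, w) \<partial>lborel) \<in> borel_measurable M"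
proof -
  have meas: "(\<lambda>z. F z * indicator ({0..T} \<times> space M) z) \<in> borel_measurable (lborel \<Otimes>\<^sub>M M)"
    using F unfolding time_space_def
    by (subst (asm) borel_measurable_restrict_space_iff_ennreal) (use time_space_set in auto)
  have "(\<lambda>(w, t). F (t, w) * indicator ({0..T} \<times> space M) (t, w)) \<in> borel_measurable (M \<Otimes>\<^sub>M lborel)"
    using measurable_pair_swap[OF meas] by simp
  then have "(\<lambda>w. \<integral>\<^sup>+ t. F (t, w) * indicator ({0..T} \<times> space M) (t, w) \<partial>lborel) \<in> borel_measurable M"
    by (rule lborel.borel_measurable_nn_integral)
  then show ?thesis
    by (rule measurable_cong[THEN iffD1, rotated]) (auto intro!: nn_integral_cong simp: indicator_def)
qed

lemma nn_integral_time_space_le: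
  assumes F: "F \<in> borel_measurable (time_space T)" and T: "0 \<le> T"
    and le: "\<And>t. t \<in> {0..T} \<Longrightarrow> (\<integral>\<^sup>+ w. F (t, w) \<partial>M) \<le> c"
  shows "(\<integral>\<^sup>+ z. F z \<partial>time_space T) \<le> c * ennreal T"
proof -
  have "(\<integral>\<^sup>+ z. F z \<partial>time_space T) \<le> (\<integral>\<^sup>+ t\<in>{0..T}. c \<partial>lborel)"
    unfolding nn_integral_time_space(2)[OF F, symmetric]
    by (intro nn_integral_mono) (use le in \<open>auto simp: indicator_def\<close>)
  also have "\<dots> = c * ennreal T"
    using T by (subst nn_integral_cmult_indicator) auto
  finally show ?thesis .
qed

lemma nn_integral_time_space_finite:
  assumes F: "F \<in> borel_measurable (time_space T)" and T: "0 \<le> T" and c: "c < \<infinity>"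
    and le: "\<And>t. t \<in> {0..T} \<Longrightarrow> (\<integral>\<^sup>+ w. F (t, w) \<partial>M) \<le> c"
  shows "(\<integral>\<^sup>+ z. F z \<partial>time_space T) < \<infinity>"
proof -
  have "c * ennreal T < \<infinity>" using c by (simp add: ennreal_mult_less_top)
  with nn_integral_time_space_le[OF F T le] show ?thesis by (rule le_less_trans)
qed

text \<open>The expectation of the pathwise Gronwall bound involves only second moments of
  \<open>I\<close>, which are finite uniformly in time, so the moments of \<open>X\<close> need not
  be known to be finite beforehand.\<close>

lemma sde_solution_L2_bounded:
  fixes \<Sigma> :: "real \<Rightarrow> real ^ 'k \<Rightarrow> real ^ 'm ^ 'k"
  assumes T: "0 \<le> T" and B: "0 \<le> B" and sol: "sde_solution T x0 \<beta> \<Sigma> X"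
    and cont: "continuous_on ({0..T} \<times> UNIV) (\<lambda>(t, x). \<beta> t x)"
    and growth: "\<And>t x. t \<in> {0..T} \<Longrightarrow> norm (\<beta> t x) \<le> B * (1 + norm x)"
  obtains c :: ennreal where "c < \<infinity>" "\<And>t. t \<in> {0..T} \<Longrightarrow> (\<integral>\<^sup>+ w. ennreal ((norm (X t w))\<^sup>2) \<partial>M) \<le> c"
proof -
  from sol obtain I where Xp: "progressive T X" 
    and XC: "AE w in M. continuous_on {0..T} (\<lambda>t. X t w)"
    and int: "AE w in M. set_integrable lborel {0..T} (\<lambda>s. \<beta> s (X s w))"
    and I: "ito_integral T (\<lambda>s w. \<Sigma> s (X s w)) I"
    and eq: "AE w in M. \<forall>t\<in>{0..T}. X t w = x0 + (LBINT s:{0..t}. \<beta> s (X s w)) + I t w"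
    unfolding sde_solution_def by blast
  from I have Ip: "progressive T I" and IC: "AE w in M. continuous_on {0..T} (\<lambda>t. I t w)"
    unfolding ito_integral_def by auto
  obtain a where a: "a < \<infinity>" "\<And>t. t \<in> {0..T} \<Longrightarrow> (\<integral>\<^sup>+ w. ennreal ((norm (I t w))\<^sup>2) \<partial>M) \<le> a"
    using ito_integral_L2_bounded[OF T I] by blast
  define F where "F z = ennreal (1 + (norm (I (fst z) (snd z)))\<^sup>2)" for z
  note Im = progressive_measurable[OF T Ip]
  have F: "F \<in> borel_measurable (time_space T)"
    using Im unfolding F_def[abs_def] split_beta by measurable
  have I2: "(\<lambda>w. ennreal ((norm (I t w))\<^sup>2)) \<in> borel_measurable M" if "t \<in> {0..T}" for t
    using measurable_section_time_space[OF Im that] by simp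
  define k where "k = 2 * exp (3 * B * T)"
  have k: "0 \<le> k" unfolding k_def by simp
  have Fle: "(\<integral>\<^sup>+ w. F (t, w) \<partial>M) \<le> 1 + a" if "t \<in> {0..T}" for t
    using a(2)[OF that] I2[OF that]
    by (simp add: F_def ennreal_plus nn_integral_add emeasure_space_1 del: ennreal_plus[symmetric])
  have FT: "(\<integral>\<^sup>+ w. (\<integral>\<^sup>+ s\<in>{0..T}. F (s, w) \<partial>lborel) \<partial>M) \<le> (1 + a) * ennreal T"
    unfolding nn_integral_time_space(1)[OF F] by (rule nn_integral_time_space_le[OF F T Fle])
  define c where "c = ennreal (k * (norm x0)\<^sup>2) + ennreal (k * (2 * B)) * ((1 + a) * ennreal T) + 2 * a"
  have bound: "AE w in M. \<forall>t\<in>{0..T}. ennreal ((norm (X t w))\<^sup>2) \<le> ennreal (k * (norm x0)\<^sup>2)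
      + ennreal (k * (2 * B)) * (\<integral>\<^sup>+ s\<in>{0..T}. F (s, w) \<partial>lborel) + 2 * ennreal ((norm (I t w))\<^sup>2)"
    using XC int eq IC
  proof eventually_elim
    case (elim w)
    show ?case
    proof
      fix t assume t: "t \<in> {0..T}"
      \<comment> \<open>Continuity of the drift along the path is what makes its time integral
        differentiable in the Gronwall argument.\<close>
      have \<beta>C: "continuous_on {0..T} (\<lambda>s. \<beta> s (X s w))"
        using continuous_on_compose2[OF cont continuous_on_Pair[OF continuous_on_id elim(1)]] by auto
      have iC: "continuous_on {0..T} (\<lambda>s. 1 + (norm (I s w))\<^sup>2)"
        by (intro continuous_intros elim(4))
      define Q where "Q = integral {0..T} (\<lambda>s. 1 + (norm (I s w))\<^sup>2)"
      have Q0: "0 \<le> Q" unfolding Q_def by (intro integral_nonneg integrable_continuous_real iC) simp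
      have "X s w = x0 + integral {0..s} (\<lambda>s. \<beta> s (X s w)) + I s w" if s: "s \<in> {0..T}" for s
      proof -
        have "set_integrable lborel {0..s} (\<lambda>s. \<beta> s (X s w))"
          using s by (intro set_integrable_subset[OF elim(2)]) auto
        then show ?thesis using elim(3) s by (simp add: set_borel_integral_eq_integral(2))
      qed
      from norm_squared_le_of_integral_equation[OF B elim(4) \<beta>C this growth t]
      have "(norm (X t w))\<^sup>2 \<le> k * (norm x0)\<^sup>2 + k * (2 * B) * Q + 2 * (norm (I t w))\<^sup>2"
        unfolding k_def Q_def by (simp add: algebra_simps)
      from ennreal_leI[OF this]
      have "ennreal ((norm (X t w))\<^sup>2)
          \<le> ennreal (k * (norm x0)\<^sup>2) + ennreal (k * (2 * B)) * ennreal Q + 2 * ennreal ((norm (I t w))\<^sup>2)"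
        using k B Q0 by (simp add: ennreal_mult)
      \<comment> \<open>Written as a nonnegative integral of the jointly measurable
        \<open>F\<close>, the path quantity \<open>Q\<close> can be averaged over \<open>M\<close>
        by exchanging the order of integration.\<close>
      moreover have "ennreal Q = (\<integral>\<^sup>+ s\<in>{0..T}. F (s, w) \<partial>lborel)"
      proof -
        note si = borel_integrable_atLeastAtMost'[OF iC]
        have "(\<integral>\<^sup>+ s\<in>{0..T}. F (s, w) \<partial>lborel)
            = (\<integral>\<^sup>+ s. ennreal (indicator {0..T} s *\<^sub>R (1 + (norm (I s w))\<^sup>2)) \<partial>lborel)"
          by (intro nn_integral_cong) (auto simp: F_def indicator_def)
        also have "\<dots> = ennreal (LBINT s:{0..T}. 1 + (norm (I s w))\<^sup>2)"
          using si unfolding set_integrable_def set_lebesgue_integral_def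
          by (intro nn_integral_eq_integral) auto
        finally show ?thesis
          unfolding Q_def by (simp add: set_borel_integral_eq_integral(2)[OF si])
      qed
      ultimately show "ennreal ((norm (X t w))\<^sup>2) \<le> ennreal (k * (norm x0)\<^sup>2)
          + ennreal (k * (2 * B)) * (\<integral>\<^sup>+ s\<in>{0..T}. F (s, w) \<partial>lborel) + 2 * ennreal ((norm (I t w))\<^sup>2)"
        by simp
    qed
  qed
  have "(\<integral>\<^sup>+ w. ennreal ((norm (X t w))\<^sup>2) \<partial>M) \<le> c" if t: "t \<in> {0..T}" for t
  proof -
    note [measurable] = I2[OF t] measurable_nn_integral_time[OF F]
    have "(\<integral>\<^sup>+ w. ennreal ((norm (X t w))\<^sup>2) \<partial>M) \<le> (\<integral>\<^sup>+ w. ennreal (k * (norm x0)\<^sup>2)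
      + ennreal (k * (2 * B)) * (\<integral>\<^sup>+ s\<in>{0..T}. F (s, w) \<partial>lborel) + 2 * ennreal ((norm (I t w))\<^sup>2) \<partial>M)"
      using bound t by (intro nn_integral_mono_AE) (auto elim!: eventually_mono)
    also have "\<dots> = ennreal (k * (norm x0)\<^sup>2)
      + ennreal (k * (2 * B)) * (\<integral>\<^sup>+ w. (\<integral>\<^sup>+ s\<in>{0..T}. F (s, w) \<partial>lborel) \<partial>M)
      + 2 * (\<integral>\<^sup>+ w. ennreal ((norm (I t w))\<^sup>2) \<partial>M)"
      by (simp add: nn_integral_add nn_integral_cmult[OF I2[OF t]]
          nn_integral_cmult[OF measurable_nn_integral_time[OF F]] emeasure_space_1)
    also have "\<dots> \<le> c"
      unfolding c_def by (intro add_mono mult_left_mono FT a(2)[OF t]) auto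
    finally show ?thesis .
  qed
  moreover have "c < \<infinity>"
    using a(1) unfolding c_def by (simp add: ennreal_mult_less_top)
  ultimately show thesis using that by blast
qed


lemma time_space_integrable_bounded:
  fixes F :: "real \<times> 'w \<Rightarrow> real"
  assumes F: "F \<in> borel_measurable (time_space T)" and T: "0 \<le> T"
    and le: "\<And>t w. t \<in> {0..T} \<Longrightarrow> w \<in> space M \<Longrightarrow> \<bar>F (t, w)\<bar> \<le> c"
  shows "integrable (time_space T) F"
proof (rule integrableI_bounded[OF F])
  have meas: "(\<lambda>z. ennreal (norm (F z))) \<in> borel_measurable (time_space T)"
    using F by measurable
  have "(\<integral>\<^sup>+ w. ennreal (norm (F (t, w))) \<partial>M) \<le> ennreal c" if "t \<in> {0..T}" for t
  proof -
    have "(\<integral>\<^sup>+ w. ennreal (norm (F (t, w))) \<partial>M) \<le> (\<integral>\<^sup>+ w. ennreal c \<partial>M)"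
      by (intro nn_integral_mono ennreal_leI) (use le[OF that] in auto)
    then show ?thesis by (simp add: emeasure_space_1)
  qed
  moreover have "ennreal c < \<infinity>" by simp
  ultimately show "(\<integral>\<^sup>+ z. ennreal (norm (F z)) \<partial>time_space T) < \<infinity>"
    by (intro nn_integral_time_space_finite[OF meas T])
qed

text \<open>The first part allows time integrals to be split along almost every path, the second
  allows the expectations of the results to be split.\<close>

lemma time_space_Fubini:
  fixes F :: "real \<times> 'w \<Rightarrow> real"
  assumes F: "integrable (time_space T) F"
  shows "AE w in M. set_integrable lborel {0..T} (\<lambda>t. F (t, w))"
    "integrable M (\<lambda>w. LBINT t:{0..T}. F (t, w))"
proof -
  interpret P: pair_sigma_finite lborel M ..
  have int: "integrable (lborel \<Otimes>\<^sub>M M) (\<lambda>(t, w). indicator ({0..T} \<times> space M) (t, w) *\<^sub>R F (t, w))"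
    using F time_space_set[of T] sets.Int_space_eq2[OF time_space_set[of T]] unfolding time_space_def
    by (subst (asm) integrable_restrict_space) (simp_all only: case_prod_unfold prod.collapse)
  have eq: "indicator ({0..T} \<times> space M) (t, w) = (indicator {0..T} t :: real)" if "w \<in> space M" for t w
    using that by (auto simp: indicator_def)
  have "AE w in M. integrable lborel (\<lambda>t. indicator ({0..T} \<times> space M) (t, w) *\<^sub>R F (t, w))"
    by (rule P.AE_integrable_snd[OF int])
  then show "AE w in M. set_integrable lborel {0..T} (\<lambda>t. F (t, w))"
    using AE_space by eventually_elim (simp add: eq set_integrable_def)
  have "integrable M (\<lambda>w. \<integral>t. indicator ({0..T} \<times> space M) (t, w) *\<^sub>R F (t, w) \<partial>lborel)"
    by (rule P.integrable_snd[OF int])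
  then show "integrable M (\<lambda>w. LBINT t:{0..T}. F (t, w))"
    by (rule Bochner_Integration.integrable_cong[THEN iffD1, rotated -1]) (simp_all add: eq set_lebesgue_integral_def)
qed

end

text \<open>Compare with the point \<open>(0, a0)\<close>: as \<open>A\<close> lies in a ball of
  radius \<open>r\<close>, the action variable adds at most \<open>2 * r\<close> to the distance,
  which is absorbed into \<open>B\<close>.\<close>

lemma lipschitz_on_linear_growth:
  fixes b :: "('a :: real_normed_vector) \<times> ('b :: real_normed_vector) \<Rightarrow> 'c :: real_normed_vector"
  assumes L: "L-lipschitz_on (UNIV \<times> A) b" and A: "bounded A"
  obtains B where "0 \<le> B" "\<And>x a. a \<in> A \<Longrightarrow> norm (b (x, a)) \<le> B * (1 + norm x)"
proof (cases "A = {}")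
  case True
  then show thesis using that[of 0] by simp
next
  case False
  then obtain a0 where a0: "a0 \<in> A" by auto
  from A obtain r where r: "\<And>a. a \<in> A \<Longrightarrow> norm a \<le> r" "0 < r" by (auto simp: bounded_pos)
  have L0: "0 \<le> L" using L by (rule lipschitz_on_nonneg)
  define B where "B = norm (b (0, a0)) + L * (1 + 2 * r)"
  have "norm (b (x, a)) \<le> B * (1 + norm x)" if a: "a \<in> A" for x a
  proof -
    have "norm (b (x, a)) \<le> norm (b (0, a0)) + dist (b (x, a)) (b (0, a0))"
      by (simp add: dist_norm norm_triangle_sub)
    also have "dist (b (x, a)) (b (0, a0)) \<le> L * dist (x, a) (0, a0)"
      using a a0 by (intro lipschitz_onD[OF L]) auto
    also have "dist (x, a) (0, a0) \<le> norm x + 2 * r"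
    proof -
      have "dist (x, a) (0, a0) \<le> norm x + norm (a - a0)"
        by (simp add: dist_norm norm_Pair_le)
      also have "norm (a - a0) \<le> r + r"
        using norm_triangle_ineq4[of a a0] r(1)[OF a] r(1)[OF a0] by linarith
      finally show ?thesis by simp
    qed
    also have "norm (b (0, a0)) + L * (norm x + 2 * r) \<le> B * (1 + norm x)"
      using L0 r(2) by (simp add: B_def algebra_simps)
    finally show ?thesis using L0 by (simp add: mult_left_mono)
  qed
  moreover have "0 \<le> B" using L0 r(2) by (simp add: B_def)
  ultimately show thesis using that by blast
qed

section \<open>Integrability of the costs and decomposition of the social cost\<close>

context decentralized_game
begin

lemma T_nonneg: "0 \<le> T"
  using T_pos by simp

lemma state_L2_bounded:
  assumes i: "i \<in> {1..N}" and \<phi>: "\<phi> \<in> Pol i"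
  obtains c :: ennreal
    where "c < \<infinity>" "\<And>t. t \<in> {0..T} \<Longrightarrow> (\<integral>\<^sup>+ w. ennreal ((norm (X i \<phi> t w))\<^sup>2) \<partial>M) \<le> c"
proof -
  obtain L where L: "L-lipschitz_on (UNIV \<times> A i) (b i)" using b_lipschitz[OF i] by blast
  obtain B where B: "0 \<le> B" "\<And>x a. a \<in> A i \<Longrightarrow> norm (b i (x, a)) \<le> B * (1 + norm x)"
    using lipschitz_on_linear_growth[OF L] A[OF i] compact_imp_bounded by blast
  note pol = Pol_continuous[OF i \<phi>]
  have img: "\<phi> (t, x) \<in> A i" if "t \<in> {0..T}" for t x
    using pol that by auto
  have "continuous_on ({0..T} \<times> UNIV) (\<lambda>z. b i (snd z, \<phi> z))"
    using pol img by (intro continuous_on_compose2[OF lipschitz_on_continuous_on[OF L]] continuous_intros) auto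
  then have cont: "continuous_on ({0..T} \<times> UNIV) (\<lambda>(t, x). b i (x, \<phi> (t, x)))"
    by (simp add: split_beta)
  show thesis
    using sde_solution_L2_bounded[OF T_nonneg B(1) state_equation[OF i \<phi>] cont B(2)[OF img]] that by blast
qed

lemma state_measurable:
  assumes "i \<in> {1..N}" "\<phi> \<in> Pol i"
  shows "(\<lambda>z. X i \<phi> (fst z) (snd z)) \<in> borel_measurable (time_space T)"
proof -
  have "progressive T (X i \<phi>)"
    using state_equation[OF assms] unfolding sde_solution_def by blast
  from progressive_measurable[OF T_nonneg this] show ?thesis
    by (simp only: case_prod_unfold)
qed

lemma running_cost_integrable:
  assumes i: "i \<in> {1..N}" and \<phi>: "\<phi> \<in> Pol i"
  shows "integrable (time_space T) (\<lambda>(t, w). f i (X i \<phi> t w, \<phi> (t, X i \<phi> t w)))"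
proof -
  note pol = Pol_continuous[OF i \<phi>]
  have img: "\<phi> (t, x) \<in> A i" if "t \<in> {0..T}" for t x
    using pol that by auto
  note [measurable] = state_measurable[OF i \<phi>] measurable_time_space_fst
  define F where "F z = f i (X i \<phi> (fst z) (snd z), \<phi> (fst z, X i \<phi> (fst z) (snd z)))" for z
  \<comment> \<open>The policy is continuous only on \<open>{0..T} \<times> UNIV\<close> and
    \<open>f i\<close> only on \<open>UNIV \<times> A i\<close>, so each composition has to pass
    through a restricted Borel space.\<close>
  have "(\<lambda>z. (fst z, X i \<phi> (fst z) (snd z))) \<in> measurable (time_space T) (restrict_space borel ({0..T} \<times> UNIV))"
    by (rule measurable_restrict_space2) (auto simp: space_time_space)
  from measurable_compose[OF this borel_measurable_continuous_on_restrict] pol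
  have [measurable]: "(\<lambda>z. \<phi> (fst z, X i \<phi> (fst z) (snd z))) \<in> borel_measurable (time_space T)" by auto
  have "(\<lambda>z. (X i \<phi> (fst z) (snd z), \<phi> (fst z, X i \<phi> (fst z) (snd z))))
      \<in> measurable (time_space T) (restrict_space borel (UNIV \<times> A i))"
    by (rule measurable_restrict_space2) (auto simp: space_time_space intro: img)
  from measurable_compose[OF this borel_measurable_continuous_on_restrict[OF f_continuous[OF i]]]
  have F: "F \<in> borel_measurable (time_space T)" unfolding F_def[abs_def] .
  obtain c where c: "\<And>z. z \<in> UNIV \<times> A i \<Longrightarrow> \<bar>f i z\<bar> \<le> c * (1 + (norm z)\<^sup>2)"
    using f_growth[OF i] by blast
  obtain r where r: "\<And>a. a \<in> A i \<Longrightarrow> norm a \<le> r"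
    using A[OF i] compact_imp_bounded by (metis bounded_iff)
  \<comment> \<open>Actions are bounded by \<open>r\<close>, so quadratic growth in the pair reduces
    to quadratic growth in the state. The absolute value is taken because the sign of
    \<open>c\<close> is not given.\<close>
  define G where "G z = \<bar>c\<bar> * (1 + r\<^sup>2) + \<bar>c\<bar> * (norm (X i \<phi> (fst z) (snd z)))\<^sup>2" for z
  have FG: "norm (F (t, w)) \<le> G (t, w)" if t: "t \<in> {0..T}" for t w
  proof -
    have "norm (F (t, w)) \<le> c * (1 + (norm (X i \<phi> t w, \<phi> (t, X i \<phi> t w)))\<^sup>2)"
      using c img[OF t] unfolding F_def by simp
    also have "\<dots> \<le> \<bar>c\<bar> * (1 + (norm (X i \<phi> t w, \<phi> (t, X i \<phi> t w)))\<^sup>2)"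
      by (intro mult_right_mono) auto
    also have "\<dots> \<le> \<bar>c\<bar> * (1 + ((norm (X i \<phi> t w))\<^sup>2 + r\<^sup>2))"
      using r[OF img[OF t]] by (intro mult_left_mono add_left_mono) (auto simp: norm_Pair intro: power_mono)
    finally show ?thesis by (simp add: G_def algebra_simps)
  qed
  obtain e where e: "e < \<infinity>" "\<And>t. t \<in> {0..T} \<Longrightarrow> (\<integral>\<^sup>+ w. ennreal ((norm (X i \<phi> t w))\<^sup>2) \<partial>M) \<le> e"
    using state_L2_bounded[OF i \<phi>] by blast
  have meas: "(\<lambda>z. ennreal (norm (F z))) \<in> borel_measurable (time_space T)"
    using F by measurable
  have "(\<integral>\<^sup>+ w. ennreal (norm (F (t, w))) \<partial>M) \<le> ennreal (\<bar>c\<bar> * (1 + r\<^sup>2)) + ennreal \<bar>c\<bar> * e"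
    if t: "t \<in> {0..T}" for t
  proof -
    have [measurable]: "X i \<phi> t \<in> borel_measurable M"
      using measurable_section_time_space[OF state_measurable[OF i \<phi>] t] by simp
    have "(\<integral>\<^sup>+ w. ennreal (norm (F (t, w))) \<partial>M)
        \<le> (\<integral>\<^sup>+ w. ennreal (\<bar>c\<bar> * (1 + r\<^sup>2)) + ennreal \<bar>c\<bar> * ennreal ((norm (X i \<phi> t w))\<^sup>2) \<partial>M)"
      using ennreal_leI[OF FG[OF t]] by (intro nn_integral_mono) (simp add: G_def ennreal_mult)
    also have "\<dots> = ennreal (\<bar>c\<bar> * (1 + r\<^sup>2)) + ennreal \<bar>c\<bar> * (\<integral>\<^sup>+ w. ennreal ((norm (X i \<phi> t w))\<^sup>2) \<partial>M)"
      by (simp add: nn_integral_add nn_integral_cmult emeasure_space_1)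
    finally show ?thesis
      using e(2)[OF t] by (meson add_left_mono mult_left_mono order_trans zero_le)
  qed
  moreover have "ennreal (\<bar>c\<bar> * (1 + r\<^sup>2)) + ennreal \<bar>c\<bar> * e < \<infinity>"
    using e(1) by (simp add: ennreal_mult_less_top)
  ultimately have "(\<integral>\<^sup>+ z. ennreal (norm (F z)) \<partial>time_space T) < \<infinity>"
    by (intro nn_integral_time_space_finite[OF meas T_nonneg])
  with F have "integrable (time_space T) F" by (rule integrableI_bounded)
  then show ?thesis unfolding F_def[abs_def] by (simp only: case_prod_unfold)
qed

text \<open>Here the moment bound is used at the single time \<open>T\<close>; a bound on the time
  average of the second moment would not suffice.\<close>

lemma terminal_cost_integrable:
  assumes i: "i \<in> {1..N}" and \<phi>: "\<phi> \<in> Pol i"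
  shows "integrable M (\<lambda>w. g i (X i \<phi> T w))"
proof -
  have T: "T \<in> {0..T}" using T_nonneg by simp
  have [measurable]: "X i \<phi> T \<in> borel_measurable M"
    using measurable_section_time_space[OF state_measurable[OF i \<phi>] T] by simp
  have [measurable]: "g i \<in> borel_measurable borel"
    by (rule borel_measurable_continuous_onI[OF g_continuous[OF i]])
  obtain c where c: "\<And>x. \<bar>g i x\<bar> \<le> c * (1 + (norm x)\<^sup>2)" using g_growth[OF i] by blast
  obtain e where e: "e < \<infinity>" "\<And>t. t \<in> {0..T} \<Longrightarrow> (\<integral>\<^sup>+ w. ennreal ((norm (X i \<phi> t w))\<^sup>2) \<partial>M) \<le> e"
    using state_L2_bounded[OF i \<phi>] by blast
  have "integrable M (\<lambda>w. (norm (X i \<phi> T w))\<^sup>2)"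
    using e(1) e(2)[OF T] by (intro integrableI_bounded) auto
  then have "integrable M (\<lambda>w. c * (1 + (norm (X i \<phi> T w))\<^sup>2))" by simp
  then show ?thesis
    by (rule Bochner_Integration.integrable_bound) (use order_trans[OF c abs_ge_self] in auto)
qed

lemma interaction_integrable:
  assumes i: "i \<in> {1..N}" "\<phi> \<in> Pol i" and j: "j \<in> {1..N}" "\<psi> \<in> Pol j"
  shows "integrable (time_space T) (\<lambda>(t, w). K (X i \<phi> t w - X j \<psi> t w))"
proof -
  obtain c where c: "\<And>x. \<bar>K x\<bar> \<le> c" using K_bounded by (auto simp: bounded_iff)
  have [measurable]: "K \<in> borel_measurable borel"
    by (rule borel_measurable_continuous_onI[OF K_continuous])
  note [measurable] = state_measurable[OF i] state_measurable[OF j]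
  show ?thesis
    unfolding split_beta by (rule time_space_integrable_bounded[OF _ T_nonneg]) (auto intro: c)
qed

lemma profile_component: "\<phi> \<in> profiles \<Longrightarrow> i \<in> {1..N} \<Longrightarrow> \<phi> i \<in> Pol i"
  unfolding profiles_def by auto

text \<open>Without the integrability established above this could fail: a non-integrable cost would make
  both expectations collapse to \<open>0\<close>.\<close>

lemma J_decomposition:
  assumes i: "i \<in> {1..N}" and \<phi>: "\<phi> \<in> profiles"
  shows "J i \<phi> = C i \<phi> + (\<Sum>j\<in>{1..N} - {i}. lam i j * Kint i j \<phi>)"
proof -
  note Pi = profile_component[OF \<phi> i]
  define a where "a w = (LBINT t:{0..T}. f i (X i (\<phi> i) t w, \<phi> i (t, X i (\<phi> i) t w)))" for w
  define k where "k j w = (LBINT t:{0..T}. K (X i (\<phi> i) t w - X j (\<phi> j) t w))" for j w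
  note running = time_space_Fubini[OF running_cost_integrable[OF i Pi]]
  have inter: "AE w in M. set_integrable lborel {0..T} (\<lambda>t. K (X i (\<phi> i) t w - X j (\<phi> j) t w))"
      "integrable M (k j)" if "j \<in> {1..N} - {i}" for j
    using time_space_Fubini[OF interaction_integrable[OF i Pi, of j "\<phi> j"]] that profile_component[OF \<phi>]
    by (auto simp: k_def[abs_def])
  have inta: "integrable M a" using running(2) by (simp add: a_def[abs_def])
  note intg = terminal_cost_integrable[OF i Pi]
  have "AE w in M. \<forall>j\<in>{1..N} - {i}. set_integrable lborel {0..T} (\<lambda>t. K (X i (\<phi> i) t w - X j (\<phi> j) t w))"
    using inter(1) by (intro AE_finite_allI) auto
  with running(1)
  \<comment> \<open>Integrability of every summand along the path is what permits the additive
    split; it holds off one null set because there are finitely many \<open>j\<close>.\<close>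
  have split: "AE w in M. (LBINT t:{0..T}. (f i (X i (\<phi> i) t w, \<phi> i (t, X i (\<phi> i) t w)) +
        (\<Sum>j\<in>{1..N} - {i}. lam i j * K (X i (\<phi> i) t w - X j (\<phi> j) t w)))) + g i (X i (\<phi> i) T w)
      = (a w + g i (X i (\<phi> i) T w)) + (\<Sum>j\<in>{1..N} - {i}. lam i j * k j w)"
  proof eventually_elim
    case (elim w)
    have K1: "set_integrable lborel {0..T} (\<lambda>t. lam i j * K (X i (\<phi> i) t w - X j (\<phi> j) t w))"
      if "j \<in> {1..N} - {i}" for j
      using elim(2) that by (intro set_integrable_mult_right) auto
    then have KS: "set_integrable lborel {0..T}
        (\<lambda>t. \<Sum>j\<in>{1..N} - {i}. lam i j * K (X i (\<phi> i) t w - X j (\<phi> j) t w))"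
      unfolding set_integrable_def scaleR_sum_right by (intro Bochner_Integration.integrable_sum)
    have "(LBINT t:{0..T}. \<Sum>j\<in>{1..N} - {i}. lam i j * K (X i (\<phi> i) t w - X j (\<phi> j) t w))
        = (\<Sum>j\<in>{1..N} - {i}. LBINT t:{0..T}. lam i j * K (X i (\<phi> i) t w - X j (\<phi> j) t w))"
      using K1 unfolding set_integrable_def set_lebesgue_integral_def scaleR_sum_right
      by (intro Bochner_Integration.integral_sum)
    then show ?case
      using elim(1) KS by (subst set_integral_add(2)) (auto simp: a_def k_def)
  qed
  have intS: "integrable M (\<lambda>w. \<Sum>j\<in>{1..N} - {i}. lam i j * k j w)"
    using inter(2) by (intro Bochner_Integration.integrable_sum integrable_mult_right) auto
  \<comment> \<open>\<open>integral_cong_AE\<close> needs measurability of the unsplit cost as well,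
    and this comes from Fubini applied to the whole integrand.\<close>
  have intT: "integrable (time_space T) (\<lambda>z. (case z of (t, w) \<Rightarrow> f i (X i (\<phi> i) t w, \<phi> i (t, X i (\<phi> i) t w))) +
      (\<Sum>j\<in>{1..N} - {i}. lam i j * (case z of (t, w) \<Rightarrow> K (X i (\<phi> i) t w - X j (\<phi> j) t w))))"
    using running_cost_integrable[OF i Pi] interaction_integrable[OF i Pi] profile_component[OF \<phi>]
    by (intro Bochner_Integration.integrable_add Bochner_Integration.integrable_sum integrable_mult_right) auto
  have "J i \<phi> = expectation (\<lambda>w. (a w + g i (X i (\<phi> i) T w)) + (\<Sum>j\<in>{1..N} - {i}. lam i j * k j w))"
    unfolding J_def
    using split time_space_Fubini(2)[OF intT] inta intg intS
    by (intro integral_cong_AE) (auto intro!: borel_measurable_integrable)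
  also have "\<dots> = expectation (\<lambda>w. a w + g i (X i (\<phi> i) T w)) + (\<Sum>j\<in>{1..N} - {i}. lam i j * expectation (k j))"
    using inta intg intS inter(2)
    by (subst Bochner_Integration.integral_add) (auto simp: Bochner_Integration.integral_sum)
  finally show ?thesis
    unfolding C_def Kint_def a_def k_def .
qed

lemma Kint_commute: "Kint i j \<phi> = Kint j i \<phi>"
  unfolding Kint_def using K_symmetric[of "X i (\<phi> i) t w - X j (\<phi> j) t w" for t w] by simp

text \<open>Every unordered pair occurs in two costs; since \<open>K\<close> is even, both
  occurrences carry the same \<open>Kint\<close> and their weights add.\<close>

lemma SC_decomposition:
  assumes \<phi>: "\<phi> \<in> profiles"
  shows "SC \<phi> = (\<Sum>i\<in>{1..N}. C i \<phi>) + (\<Sum>i\<in>{1..N}. \<Sum>j\<in>{i<..N}. (lam i j + lam j i) * Kint i j \<phi>)"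
proof -
  define u where "u i j = lam i j * Kint i j \<phi>" for i j
  have "(\<Sum>i\<in>{1..N}. \<Sum>j\<in>{1..N} - {i}. u i j) = (\<Sum>i\<in>{1..N}. (\<Sum>j\<in>{1..<i}. u i j) + (\<Sum>j\<in>{i<..N}. u i j))"
  proof (rule sum.cong)
    fix i assume "i \<in> {1..N}"
    then have "{1..N} - {i} = {1..<i} \<union> {i<..N}" by auto
    moreover have "{1..<i} \<inter> {i<..N} = {}" by auto
    ultimately show "(\<Sum>j\<in>{1..N} - {i}. u i j) = (\<Sum>j\<in>{1..<i}. u i j) + (\<Sum>j\<in>{i<..N}. u i j)"
      by (simp only: sum.union_disjoint finite_atLeastLessThan finite_greaterThanAtMost)
  qed simp
  also have "\<dots> = (\<Sum>i\<in>{1..N}. \<Sum>j\<in>{1..<i}. u i j) + (\<Sum>i\<in>{1..N}. \<Sum>j\<in>{i<..N}. u i j)"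
    by (rule sum.distrib)
  \<comment> \<open>The lower triangle of index pairs is carried to the upper one by exchanging the
    coordinates.\<close>
  also have "(\<Sum>i\<in>{1..N}. \<Sum>j\<in>{1..<i}. u i j) = (\<Sum>j\<in>{1..N}. \<Sum>i\<in>{j<..N}. u i j)"
    unfolding sum.Sigma[OF finite_atLeastAtMost ballI[OF finite_atLeastLessThan]]
      sum.Sigma[OF finite_atLeastAtMost ballI[OF finite_greaterThanAtMost]]
    by (rule sum.reindex_bij_witness[of _ "\<lambda>(i, j). (j, i)" "\<lambda>(i, j). (j, i)"]) auto
  finally have "(\<Sum>i\<in>{1..N}. \<Sum>j\<in>{1..N} - {i}. u i j) = (\<Sum>i\<in>{1..N}. \<Sum>j\<in>{i<..N}. u i j + u j i)"
    by (simp add: sum.distrib add.commute)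
  also have "\<dots> = (\<Sum>i\<in>{1..N}. \<Sum>j\<in>{i<..N}. (lam i j + lam j i) * Kint i j \<phi>)"
    unfolding u_def by (intro sum.cong refl) (simp add: Kint_commute distrib_right)
  finally show ?thesis
    unfolding SC_def u_def using J_decomposition[OF _ \<phi>] by (simp add: sum.distrib)
qed

end


section \<open>Comparison of the potential and the social cost\<close>

lemma finite_gamma_ratios: "finite (gamma_ratios N lam p)"
proof -
  have "gamma_ratios N lam p \<subseteq>
      (\<lambda>(i, j). (p i * lam i j + p j * lam j i) / (2 * (lam i j + lam j i))) ` ({1..N} \<times> {1..N})"
    unfolding gamma_ratios_def by force
  then show ?thesis by (rule finite_subset) simp
qed

lemma gamma_bounds:
  assumes "i \<in> {1..N}"
  shows "gamma_lower N lam p \<le> p i" "p i \<le> gamma_upper N lam p"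
proof -
  have "Min (p ` {1..N}) \<le> p i" "p i \<le> Max (p ` {1..N})" using assms by auto
  then show "gamma_lower N lam p \<le> p i" "p i \<le> gamma_upper N lam p"
    unfolding gamma_lower_def gamma_upper_def by linarith+
qed

lemma gamma_pair_bounds:
  assumes ij: "1 \<le> i" "i < j" "j \<le> N" and lam: "0 \<le> lam i j" "0 \<le> lam j i"
  shows "gamma_lower N lam p * (lam i j + lam j i) \<le> 1 / 2 * (p i * lam i j + p j * lam j i)"
    "1 / 2 * (p i * lam i j + p j * lam j i) \<le> gamma_upper N lam p * (lam i j + lam j i)"
proof -
  define s where "s = lam i j + lam j i"
  define r where "r = (p i * lam i j + p j * lam j i) / (2 * s)"
  have "gamma_lower N lam p * s \<le> 1 / 2 * (p i * lam i j + p j * lam j i) \<and>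
    1 / 2 * (p i * lam i j + p j * lam j i) \<le> gamma_upper N lam p * s"
  proof (cases "s = 0")
    \<comment> \<open>Such a pair is excluded from \<open>gamma_ratios\<close>, but nonnegativity
      makes both weights 0 and the inequalities trivial.\<close>
    case True
    then have "lam i j = 0" "lam j i = 0" using lam unfolding s_def by linarith+
    then show ?thesis by (simp add: True)
  next
    case False
    then have s: "0 < s" using lam unfolding s_def by linarith
    then have "r \<in> gamma_ratios N lam p"
      using ij unfolding gamma_ratios_def r_def s_def by blast
    then have "Min (gamma_ratios N lam p) \<le> r" "r \<le> Max (gamma_ratios N lam p)"
      using finite_gamma_ratios by auto
    then have "gamma_lower N lam p * s \<le> r * s" "r * s \<le> gamma_upper N lam p * s"
      using s unfolding gamma_lower_def gamma_upper_def by (auto intro!: mult_right_mono)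
    moreover have "r * s = 1 / 2 * (p i * lam i j + p j * lam j i)"
      using s unfolding r_def by simp
    ultimately show ?thesis by simp
  qed
  then show "gamma_lower N lam p * (lam i j + lam j i) \<le> 1 / 2 * (p i * lam i j + p j * lam j i)"
    "1 / 2 * (p i * lam i j + p j * lam j i) \<le> gamma_upper N lam p * (lam i j + lam j i)"
    unfolding s_def by auto
qed

lemma gamma_lower_pos:
  assumes coupled: "\<exists>i j. 1 \<le> i \<and> i < j \<and> j \<le> N \<and> lam i j + lam j i > 0"
    and p: "\<And>i. i \<in> {1..N} \<Longrightarrow> p i > 0"
    and lam: "\<And>i j. i \<in> {1..N} \<Longrightarrow> j \<in> {1..N} \<Longrightarrow> i \<noteq> j \<Longrightarrow> 0 \<le> lam i j"
  shows "0 < gamma_lower N lam p"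
proof -
  have "0 < r" if r: "r \<in> gamma_ratios N lam p" for r
  proof -
    obtain i j where ij: "1 \<le> i" "i < j" "j \<le> N" "lam i j + lam j i > 0"
      and r: "r = (p i * lam i j + p j * lam j i) / (2 * (lam i j + lam j i))"
      using r unfolding gamma_ratios_def by blast
    have l: "0 \<le> lam i j" "0 \<le> lam j i" and pp: "0 < p i" "0 < p j" using lam p ij by auto
    have "0 < lam i j \<or> 0 < lam j i" using ij(4) by linarith
    then have "0 < p i * lam i j + p j * lam j i"
      using l pp by (auto intro: add_pos_nonneg add_nonneg_pos)
    then show ?thesis using ij(4) unfolding r by simp
  qed
  \<comment> \<open>The value of \<open>Min\<close> on an empty set is unspecified; the coupled pair
    guarantees a genuine minimum.\<close>
  moreover have "gamma_ratios N lam p \<noteq> {}" using coupled unfolding gamma_ratios_def by blast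
  moreover have "{1..N} \<noteq> {}" using coupled by auto
  ultimately show ?thesis
    unfolding gamma_lower_def using p finite_gamma_ratios by (auto simp: Min_gr_iff)
qed

context decentralized_game
begin

lemma potential_bounds:
  assumes \<phi>: "\<phi> \<in> profiles"
    and C: "\<And>i. i \<in> {1..N} \<Longrightarrow> 0 \<le> C i \<phi>"
    and Kint: "\<And>i j. 1 \<le> i \<Longrightarrow> i < j \<Longrightarrow> j \<le> N \<Longrightarrow> 0 \<le> Kint i j \<phi>"
  shows "gamma_lower N lam p * SC \<phi> \<le> potential p \<phi>" "potential p \<phi> \<le> gamma_upper N lam p * SC \<phi>"
proof -
  have *: "0 \<le> Kint i j \<phi>" "0 \<le> lam i j" "0 \<le> lam j i" if "i \<in> {1..N}" "j \<in> {i<..N}" for i j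
    using that Kint lam_nonneg by auto
  have pot: "potential p \<phi> = (\<Sum>i\<in>{1..N}. p i * C i \<phi>) +
      (\<Sum>i\<in>{1..N}. \<Sum>j\<in>{i<..N}. 1 / 2 * (p i * lam i j + p j * lam j i) * Kint i j \<phi>)"
    unfolding potential_def sum_distrib_left by (simp add: mult.assoc)
  \<comment> \<open>Stated for arbitrary \<open>c\<close> so that the same termwise expansion serves
    both the lower and the upper factor.\<close>
  have SC: "c * SC \<phi> = (\<Sum>i\<in>{1..N}. c * C i \<phi>) +
      (\<Sum>i\<in>{1..N}. \<Sum>j\<in>{i<..N}. c * (lam i j + lam j i) * Kint i j \<phi>)" for c
    unfolding SC_decomposition[OF \<phi>] distrib_left[of c "sum _ _"] sum_distrib_left by (simp only: mult.assoc)
  show "gamma_lower N lam p * SC \<phi> \<le> potential p \<phi>"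
    unfolding SC pot
    by (intro add_mono sum_mono mult_right_mono gamma_bounds gamma_pair_bounds C *) auto
  show "potential p \<phi> \<le> gamma_upper N lam p * SC \<phi>"
    unfolding SC pot
    by (intro add_mono sum_mono mult_right_mono gamma_bounds gamma_pair_bounds C *) auto
qed

lemma profiles_nonempty: "profiles \<noteq> {}"
  unfolding profiles_def using Pol_nonempty by (simp add: PiE_eq_empty_iff)

end

theorem proposition4p7:
  fixes M :: "'w measure" and W :: "real \<Rightarrow> 'w \<Rightarrow> real ^ 'm"
    and T :: real and N :: nat
    and A :: "nat \<Rightarrow> (real ^ 'k) set"
    and Pol :: "nat \<Rightarrow> ('d::finite, 'k::finite) policy set"
    and b :: "nat \<Rightarrow> (real ^ 'd) \<times> (real ^ 'k) \<Rightarrow> real ^ 'd"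
    and \<sigma> :: "nat \<Rightarrow> (real ^ 'd) \<times> (real ^ 'k) \<Rightarrow> real ^ 'm ^ 'd"
    and \<xi> :: "nat \<Rightarrow> real ^ 'd"
    and f :: "nat \<Rightarrow> (real ^ 'd) \<times> (real ^ 'k) \<Rightarrow> real"
    and g :: "nat \<Rightarrow> real ^ 'd \<Rightarrow> real"
    and lam :: "nat \<Rightarrow> nat \<Rightarrow> real"
    and K :: "real ^ 'd \<Rightarrow> real"
    and X :: "nat \<Rightarrow> ('d, 'k) policy \<Rightarrow> real \<Rightarrow> 'w \<Rightarrow> real ^ 'd"
    and p :: "nat \<Rightarrow> real" and \<phi>p :: "nat \<Rightarrow> ('d, 'k) policy"
  assumes game: "decentralized_game M W T N A Pol b \<sigma> \<xi> f g lam K X"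
    and coupled: "\<exists>i j. 1 \<le> i \<and> i < j \<and> j \<le> N \<and> lam i j + lam j i > 0"
    and C_nonneg: "\<And>i \<phi>. i \<in> {1..N} \<Longrightarrow> \<phi> \<in> decentralized_game.profiles N Pol \<Longrightarrow>
          decentralized_game.C M T f g X i \<phi> \<ge> 0"
    and Kint_nonneg: "\<And>i j \<phi>. 1 \<le> i \<Longrightarrow> i < j \<Longrightarrow> j \<le> N \<Longrightarrow>
          \<phi> \<in> decentralized_game.profiles N Pol \<Longrightarrow>
          decentralized_game.Kint M T K X i j \<phi> \<ge> 0"
    and SC_opt_pos: "decentralized_game.SC_opt M T N Pol f g lam K X > 0"
    and p_pos: "\<And>i. i \<in> {1..N} \<Longrightarrow> p i > 0"
    and minimizer: "is_arg_min (decentralized_game.potential M T N f g lam K X p)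
          (\<lambda>\<phi>. \<phi> \<in> decentralized_game.profiles N Pol) \<phi>p"
  shows "decentralized_game.InEff M T N Pol f g lam K X \<phi>p
           \<le> gamma_upper N lam p / gamma_lower N lam p"
proof -
  interpret decentralized_game M W T N A Pol b \<sigma> \<xi> f g lam K X by (rule game)
  have bounds: "gamma_lower N lam p * SC \<phi> \<le> potential p \<phi>" "potential p \<phi> \<le> gamma_upper N lam p * SC \<phi>"
    if "\<phi> \<in> profiles" for \<phi>
    using that by (auto intro!: potential_bounds C_nonneg Kint_nonneg)
  have low: "0 < gamma_lower N lam p"
    by (rule gamma_lower_pos[OF coupled p_pos lam_nonneg])
  have prof: "\<phi>p \<in> profiles" and min: "\<And>\<phi>. \<phi> \<in> profiles \<Longrightarrow> potential p \<phi>p \<le> potential p \<phi>"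
    using minimizer by (auto simp: is_arg_min_linorder)
  have "0 < p 1" using N_pos p_pos by simp
  also have "p 1 \<le> gamma_upper N lam p" using N_pos by (intro gamma_bounds) simp
  finally have up: "0 < gamma_upper N lam p" .
  have "gamma_lower N lam p * SC \<phi>p / gamma_upper N lam p \<le> SC_opt"
    unfolding SC_opt_def
  \<comment> \<open>\<open>SC\<close> need not attain its infimum, so the rescaled cost of the
    minimizer is shown to lie below every \<open>SC \<phi>\<close>. Nonemptiness matters because the
    infimum is taken over the reals.\<close>
  proof (rule cINF_greatest[OF profiles_nonempty])
    fix \<phi> assume \<phi>: "\<phi> \<in> profiles"
    have "gamma_lower N lam p * SC \<phi>p \<le> gamma_upper N lam p * SC \<phi>"
      using bounds(1)[OF prof] min[OF \<phi>] bounds(2)[OF \<phi>] by (meson order_trans)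
    then show "gamma_lower N lam p * SC \<phi>p / gamma_upper N lam p \<le> SC \<phi>"
      using up by (simp add: pos_divide_le_eq mult.commute)
  qed
  then show ?thesis
    unfolding InEff_def using up low SC_opt_pos
    by (simp add: pos_divide_le_eq pos_le_divide_eq field_simps)
qed

end
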